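(* Let $G$ be a simple, undirected, connected graph on $n\ge 2$ vertices with minimum degree $\delta$ and maximum degree $\Delta$, adjacency eigenvalues $\lambda_1\ge \dots \ge \lambda_n$, normalized adjacency eigenvalues $\sigma_1\ge \dots \ge \sigma_n$ and normalized Perron eigenvector $\nu$. Let $\nu_{\min} = \min_i \nu_i$, $\nu_{\max} = \max_i \nu_i$, $\lambda = \max\{|\lambda_2|,|\lambda_n|\}$ and $\sigma = \max\{|\sigma_2|,|\sigma_n|\}$. Then the vertex integrity $\iota(G)$ satisfies (i) $\iota(G) \ge n\left(1-\dfrac{2\sigma\Delta}{\delta\left(\delta/\Delta+\sigma\right)}\right)$; (ii) $\iota(G) \ge n\left(1-\dfrac{2\lambda}{n(\lambda+\lambda_1)\nu_{\min}^2}\right)$; (iii) $\iota(G) \ge n\left( 1-\dfrac{2\lambda}{\lambda_1(\nu_{\min}/\nu_{\max})^4 + \lambda}\right)$.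
   Context: The vertex integrity of $G=(V,E)$ is $\iota(G)=\min_{S\subseteq V}\left(|S|+\kappa(V\setminus S)\right)$, where $\kappa(V\setminus S)$ is the largest number of vertices in a connected component of the subgraph induced by $V\setminus S$ (and $0$ if $S=V$). The adjacency eigenvalues are the eigenvalues of the adjacency matrix $A$; the normalized adjacency eigenvalues are the eigenvalues of $D^{-1/2}AD^{-1/2}$, where $D$ is the diagonal matrix of vertex degrees. The normalized Perron eigenvector $\nu$ is the unique eigenvector of $A$ for $\lambda_1$ with all entries positive and Euclidean norm $1$. *)

theory Defs
  imports
    "Graph_Theory.Graph_Theory"
    "Jordan_Normal_Form.Char_Poly"
begin

text \<open>
  Simple undirected graphs are finite symmetric digraphs without loops and parallel arcs
  (locale \<^locale>\<open>graph\<close>), so the degree of a vertex is its out-degree.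
\<close>

definition min_degree :: "('a, 'b) pre_digraph \<Rightarrow> nat" where
  "min_degree G = Min (out_degree G ` verts G)"

definition max_degree :: "('a, 'b) pre_digraph \<Rightarrow> nat" where
  "max_degree G = Max (out_degree G ` verts G)"

text \<open>
  \<open>comp_order G U\<close> is the largest number of vertices in a connected component (maximal connected
  subgraph) of the subgraph induced by \<open>U\<close>. The graph without vertices is not connected in
  the sense of \<^const>\<open>Digraph_Component.connected\<close>, so \<open>U = {}\<close> is treated separately.
\<close>

definition comp_order :: "('a, 'b) pre_digraph \<Rightarrow> 'a set \<Rightarrow> nat" where
  "comp_order G U = (if U = {} then 0 else
     Max {card (verts H) | H. pre_digraph.max_subgraph (G \<restriction> U) Digraph_Component.connected H})"

definition vertex_integrity :: "('a, 'b) pre_digraph \<Rightarrow> nat" where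
  "vertex_integrity G = Min ((\<lambda>S. card S + comp_order G (verts G - S)) ` Pow (verts G))"

text \<open>
  Matrices of a graph are taken with respect to an enumeration \<open>vs\<close> of its vertices.
\<close>

definition adj_matrix :: "('a, 'b) pre_digraph \<Rightarrow> 'a list \<Rightarrow> real mat" where
  "adj_matrix G vs = mat (length vs) (length vs)
     (\<lambda>(i, j). if (vs ! i, vs ! j) \<in> arcs_ends G then 1 else 0)"

text \<open>The matrix $D^{-1/2}$, for $D$ the diagonal matrix of vertex degrees.\<close>

definition inv_sqrt_deg_matrix :: "('a, 'b) pre_digraph \<Rightarrow> 'a list \<Rightarrow> real mat" where
  "inv_sqrt_deg_matrix G vs = mat (length vs) (length vs)
     (\<lambda>(i, j). if i = j then 1 / sqrt (real (out_degree G (vs ! i))) else 0)"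

definition normalized_adj_matrix :: "('a, 'b) pre_digraph \<Rightarrow> 'a list \<Rightarrow> real mat" where
  "normalized_adj_matrix G vs =
     inv_sqrt_deg_matrix G vs * adj_matrix G vs * inv_sqrt_deg_matrix G vs"

text \<open>
  The \<open>k\<close>-th largest eigenvalue, \<open>k = 1, 2, \<dots>\<close>, counted with multiplicity as a root of the
  characteristic polynomial. Only real eigenvalues are listed; for a symmetric real
  $n \times n$ matrix, these are all \<open>n\<close> of them.
\<close>

definition eigval :: "real mat \<Rightarrow> nat \<Rightarrow> real" where
  "eigval A k = rev (sorted_list_of_multiset (proots (char_poly A))) ! (k - 1)"

definition perron_vector :: "real mat \<Rightarrow> real vec" where
  "perron_vector A = (THE v. eigenvector A v (eigval A 1) \<and>
     (\<forall>i < dim_vec v. v $ i > 0) \<and> sqrt (v \<bullet> v) = 1)"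

end

theory Submission
  imports Defs "HOL-Analysis.L2_Norm"
begin

text \<open>
  Let \<open>S\<close> attain the vertex integrity. All components of \<open>G - S\<close> have at most
  \<open>\<iota>(G) - |S|\<close> vertices, so adding them greedily to the smaller side splits them into
  \<open>X\<close> and \<open>Y\<close> without arcs between them and with \<open>n \<le> \<iota>(G) + 2 min(|X|, |Y|)\<close>.
  If \<open>u\<close> is the unit eigenvector for the top eigenvalue \<open>\<mu>\<close> of the (normalized) adjacency
  matrix, the other eigenvalues are at most \<open>\<lambda>\<close> in absolute value, and \<open>a\<close>, \<open>b\<close> are the
  weights of \<open>X\<close>, \<open>Y\<close> with respect to \<open>u\<^sub>i\<^sup>2\<close>, then an expander mixing argument gives
  \<open>\<mu>\<^sup>2 a b \<le> \<lambda>\<^sup>2 (1 - a) (1 - b)\<close>, hence \<open>\<mu> a \<le> \<lambda> (1 - a)\<close> or \<open>\<mu> b \<le> \<lambda> (1 - b)\<close>. Bounds on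
  the entries of \<open>u\<close> turn this into a bound on \<open>min(|X|, |Y|)\<close>.
\<close>

section \<open>Orthogonal diagonalization of real symmetric matrices\<close>

text \<open>Over the complex numbers a root \<open>z\<close> of the characteristic polynomial
  exists. Moving \<open>C\<close> across the Hermitian product of an eigenvector with itself gives
  \<open>z = cnj z\<close>, and a real root of \<open>char_poly C\<close> is a root of
  \<open>char_poly M\<close>.\<close>

lemma symmetric_mat_has_real_eigenvector:
  fixes M :: "real mat"
  assumes M: "M \<in> carrier_mat n n" and sym: "M\<^sup>T = M" and n: "n > 0"
  shows "\<exists>v e. eigenvector M v e"
proof -
  define C where "C = map_mat complex_of_real M"
  have C: "C \<in> carrier_mat n n" using M by (simp add: C_def)
  have Ct: "C\<^sup>T = C" using sym by (metis C_def map_mat_transpose)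
  have "degree (char_poly C) > 0"
    using degree_monic_char_poly[OF C] n by auto
  then have "\<not> constant (poly (char_poly C))" by (simp add: constant_degree)
  from fundamental_theorem_of_algebra[OF this]
  obtain z where z: "poly (char_poly C) z = 0" by auto
  then obtain v where v: "eigenvector C v z"
    using eigenvalue_root_char_poly[OF C] by (auto simp: eigenvalue_def)
  then have vc: "v \<in> carrier_vec n" and v0: "v \<noteq> 0\<^sub>v n" and Cv: "C *\<^sub>v v = z \<cdot>\<^sub>v v"
    using C by (auto simp: eigenvector_def)
  have conjC: "conjugate (C *\<^sub>v v) = C *\<^sub>v conjugate v"
  proof (rule eq_vecI)
    fix i assume "i < dim_vec (C *\<^sub>v conjugate v)"
    then have i: "i < n" using C by simp
    show "conjugate (C *\<^sub>v v) $ i = (C *\<^sub>v conjugate v) $ i"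
      using i vc M by (simp add: C_def scalar_prod_def sum_conjugate conjugate_dist_mul)
  qed (use C in simp)
  have "z * (v \<bullet>c v) = (C *\<^sub>v v) \<bullet>c v"
    using vc by (simp add: Cv)
  also have "\<dots> = v \<bullet> (C *\<^sub>v conjugate v)"
    using transpose_vec_mult_scalar[OF C, of "conjugate v" v] vc Ct by simp
  also have "\<dots> = cnj z * (v \<bullet>c v)"
    using vc by (simp flip: conjC add: Cv conjugate_smult_vec)
  finally have "z = cnj z" using vc v0 by simp
  then have zr: "z = complex_of_real (Re z)" by (metis Reals_cnj_iff of_real_Re)
  have "poly (char_poly C) z = complex_of_real (poly (char_poly M) (Re z))"
    unfolding C_def of_real_hom.char_poly_hom[OF M] by (subst zr) simp
  with z have "poly (char_poly M) (Re z) = 0" by simp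
  then show ?thesis using eigenvalue_root_char_poly[OF M] unfolding eigenvalue_def by blast
qed

text \<open>Where \<open>w = 0\<close>, division by zero makes \<open>reflection_mat w\<close> the identity matrix.\<close>

definition reflection_mat :: "real vec \<Rightarrow> real mat" where
  "reflection_mat w = mat (dim_vec w) (dim_vec w)
     (\<lambda>(i, j). (if i = j then 1 else 0) - 2 / (w \<bullet> w) * w $ i * w $ j)"

lemma reflection_mat_carrier:
  "w \<in> carrier_vec n \<Longrightarrow> reflection_mat w \<in> carrier_mat n n"
  by (auto simp: reflection_mat_def)

lemma reflection_mat_transpose: "(reflection_mat w)\<^sup>T = reflection_mat w"
  by (rule eq_matI) (auto simp: reflection_mat_def)

text \<open>This identifies the Householder reflection: the component of \<open>x\<close> along
  \<open>w\<close> is negated and the orthogonal complement of \<open>w\<close> is fixed.\<close>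

lemma reflection_mat_mult_vec:
  assumes w: "w \<in> carrier_vec n" and x: "x \<in> carrier_vec n"
  shows "reflection_mat w *\<^sub>v x = x - (2 * (w \<bullet> x) / (w \<bullet> w)) \<cdot>\<^sub>v w"
proof (rule eq_vecI)
  fix i assume "i < dim_vec (x - (2 * (w \<bullet> x) / (w \<bullet> w)) \<cdot>\<^sub>v w)"
  then have i: "i < n" using w by simp
  have "(reflection_mat w *\<^sub>v x) $ i
      = (\<Sum>j<n. (if i = j then x $ j else 0) - 2 / (w \<bullet> w) * w $ i * (w $ j * x $ j))"
    using i w x by (auto simp: reflection_mat_def scalar_prod_def[of _ x] lessThan_atLeast0
        left_diff_distrib intro!: sum.cong)
  also have "\<dots> = x $ i - 2 / (w \<bullet> w) * w $ i * (w \<bullet> x)"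
    using i x by (simp add: sum_subtractf sum_distrib_left scalar_prod_def[of _ x] lessThan_atLeast0)
  finally show "(reflection_mat w *\<^sub>v x) $ i = (x - (2 * (w \<bullet> x) / (w \<bullet> w)) \<cdot>\<^sub>v w) $ i"
    using i w x by simp
qed (use w x in \<open>auto simp: reflection_mat_def\<close>)

lemma reflection_mat_involution:
  assumes w: "w \<in> carrier_vec n"
  shows "reflection_mat w * reflection_mat w = 1\<^sub>m n"
proof (rule eq_matI)
  fix i j assume "i < dim_row (1\<^sub>m n)" and "j < dim_col (1\<^sub>m n)"
  then have i: "i < n" and j: "j < n" by auto
  let ?R = "reflection_mat w" and ?e = "unit_vec n j :: real vec"
  have R: "?R \<in> carrier_mat n n" using w by (rule reflection_mat_carrier)
  \<comment> \<open>The coefficient along \<open>w\<close> changes sign, so the second reflection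
    adds back what the first one subtracted.\<close>
  have "w \<bullet> (?R *\<^sub>v ?e) = - (w \<bullet> ?e)"
  proof (cases "w \<bullet> w = 0")
    case True
    then have "w = 0\<^sub>v n" using conjugate_square_eq_0_vec[OF w] by simp
    then show ?thesis using R by simp
  next
    case False
    then show ?thesis
      using w by (simp add: reflection_mat_mult_vec[OF w] scalar_prod_minus_distrib[of _ n])
  qed
  then have "?R *\<^sub>v (?R *\<^sub>v ?e) = ?e"
    using w R by (intro eq_vecI) (auto simp: reflection_mat_mult_vec[OF w])
  then have "(?R * ?R) *\<^sub>v ?e = ?e" using R by simp
  then have "((?R * ?R) *\<^sub>v ?e) $ i = ?e $ i" by simp
  then show "(?R * ?R) $$ (i, j) = 1\<^sub>m n $$ (i, j)"
    using i j R by (simp del: assoc_mult_mat_vec)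
qed (use w in \<open>auto simp: reflection_mat_def\<close>)

text \<open>The reflection in the difference of two unit vectors exchanges them; here these are the
  first unit vector and \<open>v\<close>.\<close>

lemma ex_symmetric_orthogonal_mat_unit_vec:
  fixes v :: "real vec"
  assumes v: "v \<in> carrier_vec (Suc m)" and v1: "v \<bullet> v = 1"
  shows "\<exists>H \<in> carrier_mat (Suc m) (Suc m). H\<^sup>T = H \<and> H * H = 1\<^sub>m (Suc m) \<and> H *\<^sub>v unit_vec (Suc m) 0 = v"
proof -
  let ?n = "Suc m"
  let ?e = "unit_vec ?n 0 :: real vec"
  define w where "w = ?e - v"
  have w: "w \<in> carrier_vec ?n" using v by (simp add: w_def)
  have we: "w \<bullet> ?e = 1 - v $ 0"
    using w v by (simp add: w_def)
  have ww: "w \<bullet> w = 2 * (1 - v $ 0)"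
    unfolding w_def using v v1
    by (simp add: minus_scalar_prod_distrib[of _ ?n] scalar_prod_minus_distrib[of _ ?n])
  have "reflection_mat w *\<^sub>v ?e = v"
  proof (cases "w \<bullet> w = 0")
    case True
    then have "w = 0\<^sub>v ?n" using conjugate_square_eq_0_vec[OF w] by simp
    then have "?e - v = 0\<^sub>v ?n" by (simp add: w_def)
    then have "?e = v" using v by (metis (no_types, lifting) carrier_vecD eq_vecI index_minus_vec(1)
          index_unit_vec(3) index_zero_vec(1) right_minus_eq)
    then show ?thesis using True w v by (intro eq_vecI) (auto simp: reflection_mat_mult_vec[OF w])
  next
    case False
    \<comment> \<open>Both vectors have norm 1, hence
      \<open>w \<bullet> w = 2 * (w \<bullet> ?e)\<close> and exactly one copy of \<open>w\<close>
      is subtracted.\<close>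
    then have "2 * (w \<bullet> ?e) / (w \<bullet> w) = 1" using we ww by simp
    then have "reflection_mat w *\<^sub>v ?e = ?e - w" by (simp add: reflection_mat_mult_vec[OF w])
    then show ?thesis using v by (auto simp: w_def)
  qed
  then show ?thesis
    using reflection_mat_carrier[OF w] reflection_mat_transpose[of w] reflection_mat_involution[OF w]
    by blast
qed


text \<open>Deflation: conjugating by a reflection that sends the first unit vector to
  \<open>v\<close> splits off the eigenvalue \<open>e\<close>, and the remaining block of size
  \<open>m\<close> is symmetric again. The induction hypothesis is an explicit premise so that the
  step serves both inside the induction, with any eigenvector, and after it, with a prescribed
  one.\<close>

lemma orthogonal_diagonalization_Suc:
  fixes M :: "real mat"
  assumes IH: "\<And>M' :: real mat. M' \<in> carrier_mat m m \<Longrightarrow> M'\<^sup>T = M' \<Longrightarrow>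
      \<exists>P \<in> carrier_mat m m. \<exists>d. P\<^sup>T * P = 1\<^sub>m m \<and> M' * P = P * mat_diag m d"
    and M: "M \<in> carrier_mat (Suc m) (Suc m)" and sym: "M\<^sup>T = M"
    and v: "v \<in> carrier_vec (Suc m)" and v1: "v \<bullet> v = 1" and Mv: "M *\<^sub>v v = e \<cdot>\<^sub>v v"
  shows "\<exists>P \<in> carrier_mat (Suc m) (Suc m). \<exists>d. P\<^sup>T * P = 1\<^sub>m (Suc m)
      \<and> M * P = P * mat_diag (Suc m) d \<and> col P 0 = v \<and> d 0 = e"
proof -
  let ?n = "Suc m"
  let ?e = "unit_vec ?n 0 :: real vec"
  obtain H where H: "H \<in> carrier_mat ?n ?n" and Ht: "H\<^sup>T = H" and HH: "H * H = 1\<^sub>m ?n"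
    and He: "H *\<^sub>v ?e = v"
    using ex_symmetric_orthogonal_mat_unit_vec[OF v v1] by blast
  define B where "B = H * M * H"
  have B: "B \<in> carrier_mat ?n ?n" using H M by (simp add: B_def)
  have Bt: "B\<^sup>T = B"
    using H M Ht sym by (simp add: B_def transpose_mult[of _ ?n ?n _ ?n])
  have "B *\<^sub>v ?e = H *\<^sub>v (M *\<^sub>v v)"
    using H M v assoc_mult_mat_vec[of "H * M" ?n ?n H ?n ?e] by (simp add: B_def He)
  also have "\<dots> = e \<cdot>\<^sub>v (H *\<^sub>v (H *\<^sub>v ?e))"
    using H v by (simp add: Mv He mult_mat_vec)
  also have "\<dots> = e \<cdot>\<^sub>v ?e"
    using H by (simp flip: assoc_mult_mat_vec add: HH)
  finally have Be: "B *\<^sub>v ?e = e \<cdot>\<^sub>v ?e" .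
  \<comment> \<open>The first column of \<open>B\<close> vanishes below its top entry
    \<open>e\<close>, and by symmetry the first row vanishes beyond it. Hence \<open>B\<close> is
    block diagonal with blocks \<open>e\<close> and \<open>M'\<close>.\<close>
  have B0: "B $$ (i, 0) = (if i = 0 then e else 0)" if "i < ?n" for i
  proof -
    have "B $$ (i, 0) = (B *\<^sub>v ?e) $ i" using B that by simp
    then show ?thesis using that by (simp add: Be)
  qed
  have Bsym: "B $$ (i, j) = B $$ (j, i)" if "i < ?n" "j < ?n" for i j
    using arg_cong[OF Bt, of "\<lambda>X. X $$ (j, i)"] that B by simp
  define M' where "M' = mat m m (\<lambda>(i, j). B $$ (Suc i, Suc j))"
  have M': "M' \<in> carrier_mat m m" by (simp add: M'_def)
  have "M'\<^sup>T = M'" by (rule eq_matI) (auto simp: M'_def Bsym)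
  from IH[OF M' this] obtain P' d' where P': "P' \<in> carrier_mat m m"
    and P'1: "P'\<^sup>T * P' = 1\<^sub>m m" and MP': "M' * P' = P' * mat_diag m d'" by blast
  define d where "d = case_nat e d'"
  have B_block: "B = four_block_mat (mat_diag 1 (\<lambda>_. e)) (0\<^sub>m 1 m) (0\<^sub>m m 1) M'"
  proof (rule eq_matI)
    fix i j
    assume "i < dim_row (four_block_mat (mat_diag 1 (\<lambda>_. e)) (0\<^sub>m 1 m) (0\<^sub>m m 1) M')"
      and "j < dim_col (four_block_mat (mat_diag 1 (\<lambda>_. e)) (0\<^sub>m 1 m) (0\<^sub>m m 1) M')"
    then have ij: "i < ?n" "j < ?n" using M' by (auto simp: mat_diag_def)
    show "B $$ (i, j) = four_block_mat (mat_diag 1 (\<lambda>_. e)) (0\<^sub>m 1 m) (0\<^sub>m m 1) M' $$ (i, j)"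
      using ij B0[OF ij(1)] B0[OF ij(2)] Bsym[OF ij] M'
      by (cases i; cases j) (auto simp: mat_diag_def M'_def)
  qed (use B M' in \<open>auto simp: mat_diag_def\<close>)
  have D_block: "mat_diag ?n d = four_block_mat (mat_diag 1 (\<lambda>_. e)) (0\<^sub>m 1 m) (0\<^sub>m m 1) (mat_diag m d')"
    by (rule eq_matI) (auto simp: mat_diag_def d_def split: nat.split)
  define Q where "Q = four_block_mat (1\<^sub>m 1) (0\<^sub>m 1 m) (0\<^sub>m m 1) P'"
  have Q: "Q \<in> carrier_mat ?n ?n"
    using four_block_carrier_mat[OF one_carrier_mat[of 1] P'] by (simp add: Q_def)
  have "Q\<^sup>T * Q = four_block_mat (1\<^sub>m 1) (0\<^sub>m 1 m) (0\<^sub>m m 1) (1\<^sub>m m)"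
    unfolding Q_def using P'
    by (subst transpose_four_block_mat[of _ 1 1 _ m _ m], simp_all,
        subst mult_four_block_mat[of _ 1 1 _ m _ m _ _ 1 _ m], simp_all add: P'1)
  also have "\<dots> = 1\<^sub>m ?n" by (rule eq_matI) auto
  finally have QQ: "Q\<^sup>T * Q = 1\<^sub>m ?n" .
  have BQ: "B * Q = Q * mat_diag ?n d"
  proof -
    define E where "E = mat_diag 1 (\<lambda>_. e)"
    have E: "E \<in> carrier_mat 1 1" by (simp add: E_def)
    show ?thesis
      unfolding B_block D_block Q_def E_def[symmetric] using P' M' E
      by (simp add: mult_four_block_mat[of _ 1 1 _ m _ m _ _ 1 _ m] MP'
          left_mult_zero_mat[OF mat_diag_dim] right_add_zero_mat[of _ 1 m]
          right_add_zero_mat[of _ 1 1] right_mult_zero_mat[of _ _ 1 m] right_mult_zero_mat[of _ _ m 1]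
          right_mult_one_mat[of _ 1 1] left_mult_one_mat[of _ 1 1])
  qed
  have Qe: "Q *\<^sub>v ?e = ?e"
    by (rule eq_vecI) (use Q P' in \<open>auto simp: Q_def\<close>)
  define P where "P = H * Q"
  have P: "P \<in> carrier_mat ?n ?n" using H Q by (simp add: P_def)
  have "P\<^sup>T * P = Q\<^sup>T * (H * H) * Q"
    using H Q Ht by (simp add: P_def transpose_mult[of _ ?n ?n _ ?n]
        assoc_mult_mat[of _ ?n ?n _ ?n _ ?n])
  also have "\<dots> = 1\<^sub>m ?n" using Q QQ by (simp add: HH)
  finally have PP: "P\<^sup>T * P = 1\<^sub>m ?n" .
  have "H * B = (H * H) * M * H"
    using H M by (simp add: B_def assoc_mult_mat[of _ ?n ?n _ ?n _ ?n])
  also have "\<dots> = M * H" using H M by (simp add: HH)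
  finally have HB: "H * B = M * H" .
  have "M * P = (M * H) * Q" using H M Q by (simp add: P_def)
  also have "\<dots> = P * mat_diag ?n d"
    using H B Q mat_diag_dim[of ?n d] by (simp flip: HB add: P_def BQ del: mat_diag_dim)
  finally have MP: "M * P = P * mat_diag ?n d" .
  have "col P 0 = P *\<^sub>v ?e"
    using P by (intro eq_vecI) auto
  also have "\<dots> = v" using H Q by (simp add: P_def Qe He)
  finally have "col P 0 = v" .
  then show ?thesis using P PP MP by (intro bexI[of _ P] exI[of _ d]) (auto simp: d_def)
qed

lemma orthogonal_diagonalization:
  fixes M :: "real mat"
  assumes "M \<in> carrier_mat n n" and "M\<^sup>T = M"
  shows "\<exists>P \<in> carrier_mat n n. \<exists>d. P\<^sup>T * P = 1\<^sub>m n \<and> M * P = P * mat_diag n d"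
  using assms
proof (induction n arbitrary: M)
  case 0
  then show ?case by (intro bexI[of _ "1\<^sub>m 0"] exI conjI eq_matI) (auto simp: mat_diag_def)
next
  case (Suc m)
  obtain w e where "eigenvector M w e"
    using symmetric_mat_has_real_eigenvector[OF Suc.prems] by auto
  then have w: "w \<in> carrier_vec (Suc m)" and w0: "w \<noteq> 0\<^sub>v (Suc m)" and Mw: "M *\<^sub>v w = e \<cdot>\<^sub>v w"
    using Suc.prems by (auto simp: eigenvector_def)
  have ww: "w \<bullet> w > 0" using conjugate_square_greater_0_vec[OF w] w0 by simp
  define v where "v = (1 / sqrt (w \<bullet> w)) \<cdot>\<^sub>v w"
  have v: "v \<in> carrier_vec (Suc m)" using w by (simp add: v_def)
  have v1: "v \<bullet> v = 1" using w ww by (simp add: v_def)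
  have "M *\<^sub>v v = e \<cdot>\<^sub>v v"
    using w Suc.prems by (simp add: v_def mult_mat_vec Mw smult_smult_assoc mult.commute)
  from orthogonal_diagonalization_Suc[OF Suc.IH Suc.prems v v1 this]
  show ?case by blast
qed

text \<open>Prescribing the first column allows the mixing inequality to single out a given
  eigenvector, even if its eigenvalue is multiple.\<close>

lemma orthogonal_diagonalization_eigenvector:
  fixes M :: "real mat"
  assumes "M \<in> carrier_mat (Suc m) (Suc m)" and "M\<^sup>T = M"
    and "v \<in> carrier_vec (Suc m)" and "v \<bullet> v = 1" and "M *\<^sub>v v = e \<cdot>\<^sub>v v"
  obtains P d where "P \<in> carrier_mat (Suc m) (Suc m)" "P\<^sup>T * P = 1\<^sub>m (Suc m)"
    "M * P = P * mat_diag (Suc m) d" "col P 0 = v" "d 0 = e"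
  using orthogonal_diagonalization_Suc[OF orthogonal_diagonalization assms] by blast

text \<open>The inverse of \<open>P\<close> is its transpose, so \<open>M\<close> is similar to the
  diagonal matrix and both have the same characteristic polynomial. Thus \<open>eigval\<close> can
  be read off any orthogonal diagonalization, in whatever order it lists the eigenvalues.\<close>

lemma orthogonal_diagonalization_proots:
  fixes M :: "real mat"
  assumes M: "M \<in> carrier_mat n n" and P: "P \<in> carrier_mat n n" and PP: "P\<^sup>T * P = 1\<^sub>m n"
    and MP: "M * P = P * mat_diag n d"
  shows "proots (char_poly M) = mset (map d [0..<n])"
proof -
  let ?D = "mat_diag n d"
  have Pt: "P\<^sup>T \<in> carrier_mat n n" using P by simp
  have PPt: "P * P\<^sup>T = 1\<^sub>m n"
    using mat_mult_left_right_inverse[OF Pt P PP] .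
  have "P * ?D * P\<^sup>T = M * (P * P\<^sup>T)" using M P by (simp flip: MP)
  then have MPD: "M = P * ?D * P\<^sup>T" using M by (simp add: PPt)
  have "similar_mat_wit M ?D P P\<^sup>T"
    using M P PP PPt MPD by (auto simp: similar_mat_wit_def Let_def)
  then have "char_poly M = char_poly ?D"
    by (intro char_poly_similar) (auto simp: similar_mat_def)
  also have "\<dots> = (\<Prod>a \<leftarrow> map d [0..<n]. [:- a, 1:])"
    by (subst char_poly_upper_triangular[of _ n])
      (auto simp: upper_triangular_def mat_diag_def diag_mat_def intro!: arg_cong[of _ _ prod_list])
  finally have *: "char_poly M = (\<Prod>a \<leftarrow> map d [0..<n]. [:- a, 1:])" .
  have "proots (\<Prod>a \<leftarrow> xs. [:- a, 1:]) = mset xs" for xs :: "real list"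
    by (induction xs) (simp_all add: proots_mult prod_list_zero_iff image_iff
        del: mult_pCons_left)
  then show ?thesis unfolding * .
qed

lemma col_diagonalization:
  fixes M :: "real mat"
  assumes M: "M \<in> carrier_mat n n" and P: "P \<in> carrier_mat n n" and PP: "P\<^sup>T * P = 1\<^sub>m n"
    and MP: "M * P = P * mat_diag n d" and i: "i < n"
  shows "col P i \<bullet> col P i = 1" and "M *\<^sub>v col P i = d i \<cdot>\<^sub>v col P i"
proof -
  have "col P i \<bullet> col P i = (P\<^sup>T * P) $$ (i, i)" using P i by simp
  then show "col P i \<bullet> col P i = 1" using i by (simp add: PP)
  have "M *\<^sub>v col P i = col (M * P) i" using col_mult2[OF M P i] by simp
  also have "\<dots> = d i \<cdot>\<^sub>v col P i"
    using P i by (intro eq_vecI) (auto simp: MP mat_diag_mult_right[OF P])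
  finally show "M *\<^sub>v col P i = d i \<cdot>\<^sub>v col P i" .
qed

section \<open>Top eigenvalue and spectral gap\<close>

text \<open>Only one copy of the maximum is split off, so \<open>R\<close> may still contain
  \<open>a\<close>. The elements of \<open>R\<close> occupy positions 1 to
  \<open>length L - 1\<close> of the descending list, whose ends bound them.\<close>

lemma mset_desc_nth:
  fixes L :: "'a :: linorder list"
  assumes L: "mset L = add_mset a R" and sorted: "sorted (rev L)" and max: "\<And>x. x \<in># R \<Longrightarrow> x \<le> a"
  shows "L ! 0 = a" and "x \<in># R \<Longrightarrow> x \<le> L ! 1 \<and> L ! (length L - 1) \<le> x"
proof -
  obtain b K where bK: "L = b # K" using L by (cases L) auto
  have K_le: "\<And>x. x \<in> set K \<Longrightarrow> x \<le> b" using sorted by (auto simp: bK sorted_append)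
  have "b \<in># add_mset a R" and "a \<in> set L" using L by (metis bK list.set_intros(1) set_mset_mset)
      (metis L set_mset_mset union_single_eq_member)
  then have "b = a" using max K_le by (fastforce simp: bK)
  then show "L ! 0 = a" by (simp add: bK)
  have R: "R = mset K" using L \<open>b = a\<close> by (simp add: bK)
  show "x \<le> L ! 1 \<and> L ! (length L - 1) \<le> x" if "x \<in># R"
  proof -
    from that obtain k where k: "k < length K" "x = K ! k" by (auto simp: R in_set_conv_nth)
    have "sorted_wrt (\<ge>) K" using sorted by (simp add: bK sorted_append sorted_wrt_rev)
    then have desc: "K ! j \<le> K ! i" if "i \<le> j" "j < length K" for i j
      using that sorted_wrt_nth_less[of "(\<ge>)" K i j] by (cases "i = j") auto
    show ?thesis using desc[of 0 k] desc[of k "length K - 1"] k by (auto simp: bK nth_Cons')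
  qed
qed

text \<open>A single index \<open>k\<close> is left out rather than every index with the top value,
  in accordance with multiplicities. Each remaining entry lies between \<open>eigval M n\<close> and
  \<open>eigval M 2\<close>, which bounds its absolute value.\<close>

lemma eigval_proots:
  assumes roots: "proots (char_poly M) = mset (map d [0..<n])"
    and k: "k < n" and max: "\<And>i. i < n \<Longrightarrow> d i \<le> d k"
  shows "eigval M 1 = d k"
    and "i < n \<Longrightarrow> i \<noteq> k \<Longrightarrow> \<bar>d i\<bar> \<le> max \<bar>eigval M 2\<bar> \<bar>eigval M n\<bar>"
proof -
  define L where "L = rev (sorted_list_of_multiset (proots (char_poly M)))"
  define R where "R = mset_set ({0..<n} - {k})"
  have ms: "mset L = add_mset (d k) (image_mset d R)"
  proof -
    have "mset [0..<n] = mset_set (insert k ({0..<n} - {k}))" using k by (simp add: insert_absorb)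
    also have "\<dots> = add_mset k R" unfolding R_def by (subst mset_set.insert) auto
    finally show ?thesis by (simp add: L_def roots)
  qed
  have len: "length L = n"
    using arg_cong[OF roots, of size] by (simp add: L_def flip: size_mset)
  have sorted: "sorted (rev L)" by (simp add: L_def)
  have max': "x \<in># image_mset d R \<Longrightarrow> x \<le> d k" for x by (auto simp: R_def max)
  show "eigval M 1 = d k" using mset_desc_nth(1)[OF ms sorted max'] by (simp add: eigval_def L_def)
  assume "i < n" "i \<noteq> k"
  then have "d i \<in># image_mset d R" by (auto simp: R_def)
  from mset_desc_nth(2)[OF ms sorted max' this]
  have "d i \<le> eigval M 2" "eigval M n \<le> d i" using len by (auto simp: eigval_def L_def numeral_2_eq_2)
  then show "\<bar>d i\<bar> \<le> max \<bar>eigval M 2\<bar> \<bar>eigval M n\<bar>" by linarith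
qed

text \<open>Parseval's identity for the orthonormal basis of columns of \<open>P\<close>, in which
  \<open>M\<close> acts diagonally.\<close>

lemma scalar_prod_diagonalized:
  fixes M :: "real mat"
  assumes M: "M \<in> carrier_mat n n" and P: "P \<in> carrier_mat n n" and PP: "P\<^sup>T * P = 1\<^sub>m n"
    and MP: "M * P = P * mat_diag n d" and x: "x \<in> carrier_vec n" and y: "y \<in> carrier_vec n"
  shows "x \<bullet> y = (\<Sum>i<n. (col P i \<bullet> x) * (col P i \<bullet> y))"
    and "x \<bullet> (M *\<^sub>v y) = (\<Sum>i<n. d i * (col P i \<bullet> x) * (col P i \<bullet> y))"
proof -
  have Pt: "P\<^sup>T \<in> carrier_mat n n" using P by simp
  have PPt: "P * P\<^sup>T = 1\<^sub>m n" using mat_mult_left_right_inverse[OF Pt P PP] .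
  let ?x = "P\<^sup>T *\<^sub>v x" and ?y = "P\<^sup>T *\<^sub>v y"
  have xc: "?x \<in> carrier_vec n" and yc: "?y \<in> carrier_vec n"
    using mult_mat_vec_carrier[OF Pt] x y by auto
  have PP_id: "P *\<^sub>v (P\<^sup>T *\<^sub>v z) = z" if "z \<in> carrier_vec n" for z
    using that P assoc_mult_mat_vec[OF P Pt that] by (simp add: PPt)
  have nth: "?x $ i = col P i \<bullet> x" "?y $ i = col P i \<bullet> y" if "i < n" for i
    using that P by auto
  have "x \<bullet> y = ?x \<bullet> ?y"
    using transpose_vec_mult_scalar[OF P yc x] y by (simp add: PP_id)
  then show "x \<bullet> y = (\<Sum>i<n. (col P i \<bullet> x) * (col P i \<bullet> y))"
    using nth P by (simp add: scalar_prod_def[of ?x] lessThan_atLeast0)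
  have D: "mat_diag n d *\<^sub>v ?y = vec n (\<lambda>i. d i * (col P i \<bullet> y))"
  proof (rule eq_vecI)
    fix i assume "i < dim_vec (vec n (\<lambda>i. d i * (col P i \<bullet> y)))"
    then have i: "i < n" by simp
    have "(mat_diag n d *\<^sub>v ?y) $ i = (\<Sum>j<n. (if i = j then d j else 0) * ?y $ j)"
      using i P by (simp add: mat_diag_def scalar_prod_def[of _ ?y] lessThan_atLeast0)
    also have "\<dots> = (\<Sum>j<n. if i = j then d j * ?y $ j else 0)"
      by (intro sum.cong) auto
    finally have "(mat_diag n d *\<^sub>v ?y) $ i = d i * ?y $ i" using i by simp
    then show "(mat_diag n d *\<^sub>v ?y) $ i = vec n (\<lambda>i. d i * (col P i \<bullet> y)) $ i"
      using i nth by simp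
  qed (simp add: mat_diag_def)
  have "M *\<^sub>v y = (M * P) *\<^sub>v ?y"
    using M P yc y assoc_mult_mat_vec[OF M P yc] by (simp add: PP_id)
  also have "\<dots> = P *\<^sub>v (mat_diag n d *\<^sub>v ?y)"
    using assoc_mult_mat_vec[OF P mat_diag_dim yc] by (simp add: MP)
  finally have "x \<bullet> (M *\<^sub>v y) = ?x \<bullet> (mat_diag n d *\<^sub>v ?y)"
    using transpose_vec_mult_scalar[OF P _ x, of "mat_diag n d *\<^sub>v ?y"] by (simp add: D)
  then show "x \<bullet> (M *\<^sub>v y) = (\<Sum>i<n. d i * (col P i \<bullet> x) * (col P i \<bullet> y))"
    using nth P by (simp add: D scalar_prod_def[of ?x] lessThan_atLeast0 mult_ac)
qed

text \<open>In an eigenbasis,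
  \<open>eigval M 1 * (x \<bullet> x) - x \<bullet> (M *\<^sub>v x)\<close> is the sum of the
  nonnegative terms \<open>(d k - d i) * (col P i \<bullet> x)\<^sup>2\<close>. If it is zero, every
  component of \<open>x\<close> outside the top eigenspace vanishes.\<close>

lemma eigval_1:
  fixes M :: "real mat"
  assumes M: "M \<in> carrier_mat n n" and sym: "M\<^sup>T = M" and n: "n > 0"
  shows eigval_1_rayleigh: "x \<in> carrier_vec n \<Longrightarrow> x \<bullet> (M *\<^sub>v x) \<le> eigval M 1 * (x \<bullet> x)"
    and eigval_1_rayleigh_eq: "x \<in> carrier_vec n \<Longrightarrow> x \<bullet> (M *\<^sub>v x) = eigval M 1 * (x \<bullet> x)
      \<Longrightarrow> M *\<^sub>v x = eigval M 1 \<cdot>\<^sub>v x"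
    and eigval_1_unit_eigenvector: "\<exists>v \<in> carrier_vec n. v \<bullet> v = 1 \<and> M *\<^sub>v v = eigval M 1 \<cdot>\<^sub>v v"
proof -
  obtain P d where P: "P \<in> carrier_mat n n" and PP: "P\<^sup>T * P = 1\<^sub>m n"
    and MP: "M * P = P * mat_diag n d"
    using orthogonal_diagonalization[OF M sym] by blast
  have "Max (d ` {..<n}) \<in> d ` {..<n}" using n by (intro Max_in) auto
  then obtain k where k: "k < n" and dk: "d k = Max (d ` {..<n})" by auto
  have max: "d i \<le> d k" if "i < n" for i using that by (simp add: dk)
  have e: "eigval M 1 = d k"
    using eigval_proots(1)[OF orthogonal_diagonalization_proots[OF M P PP MP] k max] .
  note sp = scalar_prod_diagonalized[OF M P PP MP]
  have diff: "eigval M 1 * (x \<bullet> x) - x \<bullet> (M *\<^sub>v x) = (\<Sum>i<n. (d k - d i) * (col P i \<bullet> x)\<^sup>2)"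
    if "x \<in> carrier_vec n" for x
    unfolding sp[OF that that] e sum_distrib_left sum_subtractf[symmetric]
    by (simp add: algebra_simps power2_eq_square)
  show "x \<bullet> (M *\<^sub>v x) \<le> eigval M 1 * (x \<bullet> x)" if x: "x \<in> carrier_vec n" for x
  proof -
    have "0 \<le> (\<Sum>i<n. (d k - d i) * (col P i \<bullet> x)\<^sup>2)" by (intro sum_nonneg) (simp add: max)
    then show ?thesis using diff[OF x] by linarith
  qed
  show "M *\<^sub>v x = eigval M 1 \<cdot>\<^sub>v x"
    if x: "x \<in> carrier_vec n" and eq: "x \<bullet> (M *\<^sub>v x) = eigval M 1 * (x \<bullet> x)" for x
  proof (rule eq_vecI)
    have "(\<Sum>i<n. (d k - d i) * (col P i \<bullet> x)\<^sup>2) = 0" using diff[OF x] eq by simp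
    then have *: "\<forall>i \<in> {..<n}. (d k - d i) * (col P i \<bullet> x)\<^sup>2 = 0"
      by (subst (asm) sum_nonneg_eq_0_iff) (auto simp: max)
    have **: "d i * c * (col P i \<bullet> x) = d k * (c * (col P i \<bullet> x))" if "i < n" for i c
      using bspec[OF *, of i] that by (cases "d i = d k") auto
    fix j assume "j < dim_vec (eigval M 1 \<cdot>\<^sub>v x)"
    then have j: "j < n" using x by simp
    have u: "unit_vec n j \<in> carrier_vec n" by simp
    have "unit_vec n j \<bullet> (M *\<^sub>v x) = d k * (unit_vec n j \<bullet> x)"
      unfolding sp[OF u x] sum_distrib_left by (intro sum.cong) (auto simp: **)
    then show "(M *\<^sub>v x) $ j = (eigval M 1 \<cdot>\<^sub>v x) $ j" using j x M e by simp
  qed (use M x in simp)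
  show "\<exists>v \<in> carrier_vec n. v \<bullet> v = 1 \<and> M *\<^sub>v v = eigval M 1 \<cdot>\<^sub>v v"
    using col_diagonalization[OF M P PP MP k] P k unfolding e by (intro bexI[of _ "col P k"]) auto
qed

text \<open>Take an eigenbasis whose first column is \<open>u\<close>. The subtracted term is the
  contribution of that column; the others are controlled by their eigenvalues and the Cauchy-Schwarz
  inequality. The square roots are the norms of the parts of \<open>x\<close> and \<open>y\<close>
  orthogonal to \<open>u\<close>.\<close>

lemma eigval_mixing:
  fixes M :: "real mat"
  assumes M: "M \<in> carrier_mat n n" and sym: "M\<^sup>T = M"
    and u: "u \<in> carrier_vec n" "u \<bullet> u = 1" "M *\<^sub>v u = eigval M 1 \<cdot>\<^sub>v u"
    and x: "x \<in> carrier_vec n" and y: "y \<in> carrier_vec n"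
  shows "\<bar>x \<bullet> (M *\<^sub>v y) - eigval M 1 * (u \<bullet> x) * (u \<bullet> y)\<bar>
    \<le> max \<bar>eigval M 2\<bar> \<bar>eigval M n\<bar> * (sqrt (x \<bullet> x - (u \<bullet> x)\<^sup>2) * sqrt (y \<bullet> y - (u \<bullet> y)\<^sup>2))"
proof -
  have "n \<noteq> 0" using u(1,2) by (cases "n = 0") (auto simp: scalar_prod_def)
  then obtain m where n: "n = Suc m" using not0_implies_Suc by blast
  obtain P d where P: "P \<in> carrier_mat n n" and PP: "P\<^sup>T * P = 1\<^sub>m n"
    and MP: "M * P = P * mat_diag n d" and P0: "col P 0 = u" and d0: "d 0 = eigval M 1"
    using orthogonal_diagonalization_eigenvector[OF M[unfolded n] sym u(1)[unfolded n] u(2,3)]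
    unfolding n by blast
  let ?l = "max \<bar>eigval M 2\<bar> \<bar>eigval M n\<bar>"
  note roots = orthogonal_diagonalization_proots[OF M P PP MP]
  \<comment> \<open>By the Rayleigh bound no eigenvalue exceeds \<open>d 0\<close>, so index 0 can
    be the one left out in \<open>eigval_proots\<close>.\<close>
  have max: "d i \<le> d 0" if i: "i < n" for i
  proof -
    have c: "col P i \<in> carrier_vec n" using P i by simp
    show ?thesis
      using eigval_1_rayleigh[OF M sym _ c] col_diagonalization[OF M P PP MP i] c d0 n by simp
  qed
  have d_le: "\<bar>d (Suc i)\<bar> \<le> ?l" if "i < m" for i
    using eigval_proots(2)[OF roots _ max, of "Suc i"] that n by simp
  note sp = scalar_prod_diagonalized[OF M P PP MP]
  define f where "f = (\<lambda>i. col P (Suc i) \<bullet> x)"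
  define g where "g = (\<lambda>i. col P (Suc i) \<bullet> y)"
  have f2: "x \<bullet> x - (u \<bullet> x)\<^sup>2 = (\<Sum>i<m. (f i)\<^sup>2)"
    using sp(1)[OF x x] by (simp add: n sum.lessThan_Suc_shift P0 f_def power2_eq_square del: sum.lessThan_Suc)
  have g2: "y \<bullet> y - (u \<bullet> y)\<^sup>2 = (\<Sum>i<m. (g i)\<^sup>2)"
    using sp(1)[OF y y] by (simp add: n sum.lessThan_Suc_shift P0 g_def power2_eq_square del: sum.lessThan_Suc)
  have "x \<bullet> (M *\<^sub>v y) - eigval M 1 * (u \<bullet> x) * (u \<bullet> y) = (\<Sum>i<m. d (Suc i) * f i * g i)"
    using sp(2)[OF x y] d0 by (simp add: n sum.lessThan_Suc_shift P0 f_def g_def del: sum.lessThan_Suc)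
  also have "\<bar>\<dots>\<bar> \<le> (\<Sum>i<m. ?l * (\<bar>f i\<bar> * \<bar>g i\<bar>))"
    by (intro order.trans[OF sum_abs] sum_mono) (auto simp: abs_mult mult.assoc intro!: mult_right_mono d_le)
  also have "\<dots> = ?l * (\<Sum>i<m. \<bar>f i\<bar> * \<bar>g i\<bar>)" by (simp add: sum_distrib_left)
  also have "(\<Sum>i<m. \<bar>f i\<bar> * \<bar>g i\<bar>) \<le> L2_set f {..<m} * L2_set g {..<m}"
    by (rule L2_set_mult_ineq)
  finally show ?thesis by (simp add: L2_set_def f2 g2 mult_left_mono)
qed

section \<open>Nonnegative symmetric matrices\<close>

text \<open>For a square matrix the closure condition says that the digraph of positive entries is
  strongly connected. Closed index sets are the convenient form, since the condition is applied to
  the zero set of a vector.\<close>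

definition nonneg_irreducible :: "real mat \<Rightarrow> bool" where
  "nonneg_irreducible M \<longleftrightarrow> (\<forall>i < dim_row M. \<forall>j < dim_col M. M $$ (i, j) \<ge> 0) \<and>
     (\<forall>Z \<subseteq> {..<dim_row M}. Z \<noteq> {} \<longrightarrow> (\<forall>i \<in> Z. \<forall>j < dim_col M. M $$ (i, j) > 0 \<longrightarrow> j \<in> Z)
        \<longrightarrow> Z = {..<dim_row M})"

lemma mult_mat_vec_nth_sum:
  assumes "M \<in> carrier_mat n n" and "x \<in> carrier_vec n" and "i < n"
  shows "(M *\<^sub>v x) $ i = (\<Sum>j<n. M $$ (i, j) * x $ j)"
  using assms by (simp add: scalar_prod_def lessThan_atLeast0)

text \<open>If \<open>x $ i = 0\<close>, then row \<open>i\<close> of the eigenvalue equation is a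
  vanishing sum of nonnegative terms, so \<open>x $ j = 0\<close> wherever
  \<open>M $$ (i, j) > 0\<close>. The zero set is therefore closed, and it is not everything because
  \<open>x\<close> is nonzero.\<close>

lemma nonneg_eigenvector_pos:
  assumes M: "M \<in> carrier_mat n n" and irr: "nonneg_irreducible M"
    and x: "x \<in> carrier_vec n" "x \<noteq> 0\<^sub>v n" and nonneg: "\<And>i. i < n \<Longrightarrow> x $ i \<ge> 0"
    and Mx: "M *\<^sub>v x = e \<cdot>\<^sub>v x" and i: "i < n"
  shows "x $ i > 0"
proof -
  define Z where "Z = {i. i < n \<and> x $ i = 0}"
  have closed: "j \<in> Z" if i: "i \<in> Z" and j: "j < n" and pos: "M $$ (i, j) > 0" for i j
  proof -
    have "(\<Sum>k<n. M $$ (i, k) * x $ k) = 0"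
      using mult_mat_vec_nth_sum[OF M x(1), of i] i x(1) by (simp add: Z_def Mx)
    then have "\<forall>k \<in> {..<n}. M $$ (i, k) * x $ k = 0"
      using irr M i nonneg
      by (subst (asm) sum_nonneg_eq_0_iff) (auto simp: nonneg_irreducible_def Z_def)
    from bspec[OF this, of j] show "j \<in> Z" using j pos by (auto simp: Z_def)
  qed
  have not_all: "Z \<noteq> {..<n}"
  proof
    assume "Z = {..<n}"
    then have "x = 0\<^sub>v n" using x(1) by (intro eq_vecI) (auto simp: Z_def)
    with x(2) show False ..
  qed
  have "Z \<subseteq> {..<n}" by (auto simp: Z_def)
  then have "Z = {}" using irr M closed not_all unfolding nonneg_irreducible_def
    by (metis carrier_matD)
  then have "i \<notin> Z" by simp
  then show ?thesis using nonneg[OF i] i by (simp add: Z_def)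
qed

text \<open>Existence: taking absolute values in a top eigenvector does not decrease its Rayleigh
  quotient, so the result is again a top eigenvector, and it is positive by irreducibility.
  Uniqueness: see the choice of \<open>t\<close> below. Together they give meaning to the definite
  description in \<open>perron_vector\<close>.\<close>

lemma perron_frobenius_symmetric:
  assumes M: "M \<in> carrier_mat n n" and sym: "M\<^sup>T = M" and n: "n > 0" and irr: "nonneg_irreducible M"
  shows "\<exists>!v. eigenvector M v (eigval M 1) \<and> (\<forall>i < dim_vec v. v $ i > 0) \<and> sqrt (v \<bullet> v) = 1"
proof (rule ex_ex1I)
  let ?e = "eigval M 1"
  obtain v where v: "v \<in> carrier_vec n" "v \<bullet> v = 1" "M *\<^sub>v v = ?e \<cdot>\<^sub>v v"
    using eigval_1_unit_eigenvector[OF M sym n] by blast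
  define x where "x = vec n (\<lambda>i. \<bar>v $ i\<bar>)"
  have x: "x \<in> carrier_vec n" by (simp add: x_def)
  have xx: "x \<bullet> x = 1" using v(1,2) by (simp add: x_def scalar_prod_def)
  have quad: "y \<bullet> (M *\<^sub>v y) = (\<Sum>i<n. \<Sum>j<n. y $ i * (M $$ (i, j) * y $ j))"
    if "y \<in> carrier_vec n" for y
  proof -
    have "y \<bullet> (M *\<^sub>v y) = (\<Sum>i<n. y $ i * (M *\<^sub>v y) $ i)"
      using that M by (simp add: scalar_prod_def[of y] lessThan_atLeast0)
    then show ?thesis using mult_mat_vec_nth_sum[OF M that] by (simp add: sum_distrib_left)
  qed
  have "?e = v \<bullet> (M *\<^sub>v v)" using v by simp
  also have "\<dots> \<le> x \<bullet> (M *\<^sub>v x)"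
    unfolding quad[OF v(1)] quad[OF x]
  proof (intro sum_mono)
    fix i j assume "i \<in> {..<n}" "j \<in> {..<n}"
    then have ij: "i < n" "j < n" and "M $$ (i, j) \<ge> 0"
      using irr M by (auto simp: nonneg_irreducible_def)
    then have "\<bar>v $ i * (M $$ (i, j) * v $ j)\<bar> = x $ i * (M $$ (i, j) * x $ j)"
      by (auto simp: x_def abs_mult)
    then show "v $ i * (M $$ (i, j) * v $ j) \<le> x $ i * (M $$ (i, j) * x $ j)"
      by (metis abs_ge_self)
  qed
  finally have "x \<bullet> (M *\<^sub>v x) = ?e * (x \<bullet> x)"
    using eigval_1_rayleigh[OF M sym n x] xx by simp
  from eigval_1_rayleigh_eq[OF M sym n x this] have Mx: "M *\<^sub>v x = ?e \<cdot>\<^sub>v x" .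
  have x0: "x \<noteq> 0\<^sub>v n" using xx by auto
  have "x $ i > 0" if "i < n" for i
    using nonneg_eigenvector_pos[OF M irr x x0 _ Mx that] by (simp add: x_def)
  then show "\<exists>v. eigenvector M v ?e \<and> (\<forall>i < dim_vec v. v $ i > 0) \<and> sqrt (v \<bullet> v) = 1"
    using x x0 xx Mx M by (intro exI[of _ x]) (auto simp: eigenvector_def)
next
  let ?e = "eigval M 1"
  fix v w
  assume "eigenvector M v ?e \<and> (\<forall>i < dim_vec v. v $ i > 0) \<and> sqrt (v \<bullet> v) = 1"
    and "eigenvector M w ?e \<and> (\<forall>i < dim_vec w. w $ i > 0) \<and> sqrt (w \<bullet> w) = 1"
  then have v: "v \<in> carrier_vec n" "M *\<^sub>v v = ?e \<cdot>\<^sub>v v" "\<And>i. i < n \<Longrightarrow> v $ i > 0" "v \<bullet> v = 1"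
    and w: "w \<in> carrier_vec n" "M *\<^sub>v w = ?e \<cdot>\<^sub>v w" "\<And>i. i < n \<Longrightarrow> w $ i > 0" "w \<bullet> w = 1"
    using M by (auto simp: eigenvector_def)
  \<comment> \<open>The largest \<open>t\<close> for which \<open>v - t \<cdot>\<^sub>v w\<close> is
    nonnegative. This difference vanishes at \<open>k\<close>, so it cannot be a nonzero
    eigenvector, whose entries would all be positive.\<close>
  define t where "t = Min ((\<lambda>i. v $ i / w $ i) ` {..<n})"
  have "t \<in> (\<lambda>i. v $ i / w $ i) ` {..<n}" unfolding t_def using n by (intro Min_in) auto
  then obtain k where k: "k < n" "t = v $ k / w $ k" by auto
  have t_le: "t * w $ i \<le> v $ i" if "i < n" for i
  proof -
    have "t \<le> v $ i / w $ i" unfolding t_def using that by (intro Min_le) auto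
    then show ?thesis using w(3)[OF that] by (simp add: field_simps)
  qed
  define y where "y = v - t \<cdot>\<^sub>v w"
  have y: "y \<in> carrier_vec n" using v w by (simp add: y_def)
  have "M *\<^sub>v y = M *\<^sub>v v - t \<cdot>\<^sub>v (M *\<^sub>v w)"
    using M v(1) w(1) by (simp add: y_def mult_minus_distrib_mat_vec[OF M] mult_mat_vec)
  also have "\<dots> = ?e \<cdot>\<^sub>v y"
    unfolding v(2) w(2) using v(1) w(1) by (intro eq_vecI) (auto simp: y_def algebra_simps)
  finally have My: "M *\<^sub>v y = ?e \<cdot>\<^sub>v y" .
  have "y = 0\<^sub>v n"
  proof (rule ccontr)
    assume "y \<noteq> 0\<^sub>v n"
    moreover have "y $ i \<ge> 0" if "i < n" for i using t_le[OF that] that v(1) w(1) by (simp add: y_def)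
    ultimately have "y $ k > 0" using nonneg_eigenvector_pos[OF M irr y _ _ My k(1)] by blast
    then show False using k v(1) w(1) w(3)[OF k(1)] by (simp add: y_def)
  qed
  then have y0: "y $ i = 0" if "i < n" for i using that by simp
  have nth: "v $ i = t * w $ i" if "i < n" for i
    using y0[OF that] that v(1) w(1) by (simp add: y_def)
  then have vw: "v = t \<cdot>\<^sub>v w" using v(1) w(1) by (intro eq_vecI) auto
  then have "t * t = 1" using v(4) w(1,4) by simp
  moreover have "t > 0" using k v(3) w(3) by simp
  ultimately have "t = 1" using square_eq_1_iff[of t] by auto
  then show "v = w" using vw by simp
qed

text \<open>Pairing \<open>u\<close> with the entrywise absolute value of a top eigenvector bounds the top eigenvalue by \<open>e\<close>.\<close>

lemma eigval_1_positive_eigenvector: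
  assumes M: "M \<in> carrier_mat n n" and sym: "M\<^sup>T = M" and n: "n > 0"
    and nonneg: "\<And>i j. i < n \<Longrightarrow> j < n \<Longrightarrow> M $$ (i, j) \<ge> 0"
    and u: "u \<in> carrier_vec n" "\<And>i. i < n \<Longrightarrow> u $ i > 0" "M *\<^sub>v u = e \<cdot>\<^sub>v u"
  shows "eigval M 1 = e"
proof (rule antisym)
  let ?f = "eigval M 1"
  obtain w where w: "w \<in> carrier_vec n" "w \<bullet> w = 1" "M *\<^sub>v w = ?f \<cdot>\<^sub>v w"
    using eigval_1_unit_eigenvector[OF M sym n] by blast
  define x where "x = vec n (\<lambda>i. \<bar>w $ i\<bar>)"
  have x: "x \<in> carrier_vec n" by (simp add: x_def)
  have Mx: "?f * x $ i \<le> (M *\<^sub>v x) $ i" if i: "i < n" for i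
  proof -
    have "?f * x $ i \<le> \<bar>?f * w $ i\<bar>" using i by (simp add: x_def abs_mult mult_right_mono)
    also have "?f * w $ i = (\<Sum>j<n. M $$ (i, j) * w $ j)"
      using mult_mat_vec_nth_sum[OF M w(1) i] w(1) i by (simp add: w(3))
    also have "\<bar>\<dots>\<bar> \<le> (\<Sum>j<n. \<bar>M $$ (i, j) * w $ j\<bar>)" by (rule sum_abs)
    also have "\<dots> = (\<Sum>j<n. M $$ (i, j) * x $ j)"
      using nonneg i by (intro sum.cong) (auto simp: x_def abs_mult)
    finally show ?thesis using mult_mat_vec_nth_sum[OF M x i] by simp
  qed
  have sp: "u \<bullet> z = (\<Sum>i<n. u $ i * z $ i)" if "z \<in> carrier_vec n" for z
    using that by (simp add: scalar_prod_def lessThan_atLeast0)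
  have "?f * (u \<bullet> x) = (\<Sum>i<n. u $ i * (?f * x $ i))"
    by (simp add: sp[OF x] sum_distrib_left mult_ac)
  also have "\<dots> \<le> (\<Sum>i<n. u $ i * (M *\<^sub>v x) $ i)"
    using u(2) by (intro sum_mono mult_left_mono Mx) (auto intro: less_imp_le)
  also have "\<dots> = u \<bullet> (M *\<^sub>v x)" using M x by (subst sp) auto
  also have "\<dots> = (M *\<^sub>v u) \<bullet> x" using transpose_vec_mult_scalar[OF M x u(1)] by (simp add: sym)
  also have "\<dots> = e * (u \<bullet> x)" using u(1) x by (simp add: u(3))
  finally have le: "?f * (u \<bullet> x) \<le> e * (u \<bullet> x)" .
  \<comment> \<open>Strict positivity permits cancelling this factor; it holds because
    \<open>u\<close> is positive and \<open>x\<close> is nonnegative and nonzero.\<close>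
  have "u \<bullet> x > 0"
  proof (rule ccontr)
    assume "\<not> u \<bullet> x > 0"
    moreover have "\<forall>i \<in> {..<n}. u $ i * x $ i \<ge> 0" using u(2) by (auto simp: x_def intro!: mult_nonneg_nonneg intro: less_imp_le)
    ultimately have 0: "\<forall>i \<in> {..<n}. u $ i * x $ i = 0"
      using sum_nonneg[of "{..<n}" "\<lambda>i. u $ i * x $ i"] unfolding sp[OF x]
      by (subst sum_nonneg_eq_0_iff[symmetric]) auto
    have "w $ i = 0" if "i < n" for i using bspec[OF 0, of i] that u(2)[OF that] by (auto simp: x_def)
    then show False using w(1,2) by (simp add: scalar_prod_def)
  qed
  then show "?f \<le> e" using le by simp
  \<comment> \<open>For the reverse inequality \<open>u\<close> itself is the test vector in the
    Rayleigh bound.\<close>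
  have "0 < (\<Sum>i<n. u $ i * u $ i)" using u(2) n by (intro sum_pos) auto
  then have "u \<bullet> u > 0" by (simp add: sp[OF u(1)])
  then show "e \<le> ?f" using eigval_1_rayleigh[OF M sym n u(1)] u(1) by (simp add: u(3))
qed

text \<open>
  Apply the mixing inequality to the restrictions of \<open>u\<close> to \<open>X\<close> and \<open>Y\<close>, whose inner products
  with \<open>u\<close> and whose squared norms are both the weights of \<open>X\<close> and \<open>Y\<close>.
\<close>

lemma separated_sets_weight:
  fixes M :: "real mat"
  assumes M: "M \<in> carrier_mat n n" and sym: "M\<^sup>T = M"
    and u: "u \<in> carrier_vec n" "u \<bullet> u = 1" "M *\<^sub>v u = eigval M 1 \<cdot>\<^sub>v u"
    and lam: "lam = max \<bar>eigval M 2\<bar> \<bar>eigval M n\<bar>" and e: "eigval M 1 > 0"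
    and X: "X \<subseteq> {..<n}" and Y: "Y \<subseteq> {..<n}"
    and sep: "\<And>i j. i \<in> X \<Longrightarrow> j \<in> Y \<Longrightarrow> M $$ (i, j) = 0"
  shows "eigval M 1 * (\<Sum>i\<in>X. (u $ i)\<^sup>2) \<le> lam * (1 - (\<Sum>i\<in>X. (u $ i)\<^sup>2)) \<or>
    eigval M 1 * (\<Sum>i\<in>Y. (u $ i)\<^sup>2) \<le> lam * (1 - (\<Sum>i\<in>Y. (u $ i)\<^sup>2))"
proof -
  let ?e = "eigval M 1"
  define r where "r = (\<lambda>S. vec n (\<lambda>i. if i \<in> S then u $ i else 0))"
  define w where "w = (\<lambda>S. \<Sum>i\<in>S. (u $ i)\<^sup>2)"
  have r: "r S \<in> carrier_vec n" for S by (simp add: r_def)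
  have wsum: "(\<Sum>i<n. if i \<in> S then (u $ i)\<^sup>2 else 0) = w S" if "S \<subseteq> {..<n}" for S
    using that by (simp add: w_def sum.inter_restrict[symmetric] Int_absorb1)
  have rr: "r S \<bullet> r S = w S" if "S \<subseteq> {..<n}" for S
    unfolding wsum[OF that, symmetric]
    by (auto simp: r_def scalar_prod_def lessThan_atLeast0 power2_eq_square intro!: sum.cong)
  have ur: "u \<bullet> r S = w S" if "S \<subseteq> {..<n}" for S
    unfolding wsum[OF that, symmetric]
    by (auto simp: r_def scalar_prod_def lessThan_atLeast0 power2_eq_square intro!: sum.cong)
  have w0: "w S \<ge> 0" for S by (simp add: w_def sum_nonneg)
  have w1: "w S \<le> 1" if "S \<subseteq> {..<n}" for S
  proof -
    have "w S \<le> w {..<n}" using that unfolding w_def by (intro sum_mono2) auto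
    also have "\<dots> = u \<bullet> u" using u(1) by (simp add: w_def scalar_prod_def lessThan_atLeast0 power2_eq_square)
    finally show ?thesis using u(2) by simp
  qed
  \<comment> \<open>Entries between \<open>X\<close> and \<open>Y\<close> are zero, so only the
    product \<open>?e * a * b\<close> survives on the left of the mixing inequality.\<close>
  have "r X \<bullet> (M *\<^sub>v r Y) = (\<Sum>i<n. r X $ i * (\<Sum>j<n. M $$ (i, j) * r Y $ j))"
    using M mult_mat_vec_nth_sum[OF M r] by (simp add: scalar_prod_def[of "r X"] lessThan_atLeast0)
  also have "\<dots> = 0"
    by (auto simp: r_def sep intro!: sum.neutral)
  finally have 0: "r X \<bullet> (M *\<^sub>v r Y) = 0" .
  define a b where "a = w X" and "b = w Y"
  have ab: "0 \<le> a" "a \<le> 1" "0 \<le> b" "b \<le> 1" using w0 w1 X Y by (auto simp: a_def b_def)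
  have lam0: "lam \<ge> 0" by (simp add: lam)
  have "\<bar>?e * a * b\<bar> \<le> lam * (sqrt (a - a\<^sup>2) * sqrt (b - b\<^sup>2))"
    using eigval_mixing[OF M sym u r r, of X Y] by (simp add: 0 rr[OF X] rr[OF Y] ur[OF X] ur[OF Y] lam a_def b_def)
  moreover have "a - a\<^sup>2 = a * (1 - a)" "b - b\<^sup>2 = b * (1 - b)"
    by (simp_all add: power2_eq_square right_diff_distrib)
  ultimately have le: "?e * a * b \<le> lam * sqrt ((a * (1 - a)) * (b * (1 - b)))"
    by (simp only: real_sqrt_mult)
  \<comment> \<open>If both alternatives failed, their product would give
    \<open>lam\<^sup>2 * (1 - a) * (1 - b) < ?e\<^sup>2 * a * b\<close>. Multiplied by
    \<open>a * b > 0\<close>, this contradicts the square of \<open>le\<close>.\<close>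
  have "?e * a \<le> lam * (1 - a) \<or> ?e * b \<le> lam * (1 - b)"
  proof (rule ccontr)
    assume "\<not> ?thesis"
    then have gt: "lam * (1 - a) < ?e * a" "lam * (1 - b) < ?e * b" by auto
    have "0 \<le> lam * (1 - a)" "0 \<le> lam * (1 - b)" using lam0 ab by auto
    then have prod: "(lam * (1 - a)) * (lam * (1 - b)) < (?e * a) * (?e * b)"
      by (rule mult_strict_mono'[OF gt])
    have "a \<noteq> 0" "b \<noteq> 0" using gt lam0 by auto
    then have pos: "a > 0" "b > 0" using ab by auto
    then have "a * b * ((lam * (1 - a)) * (lam * (1 - b))) < a * b * ((?e * a) * (?e * b))"
      using prod by (intro mult_strict_left_mono) auto
    also have "\<dots> = (?e * a * b)\<^sup>2" by (simp add: power2_eq_square)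
    also have "\<dots> \<le> (lam * sqrt ((a * (1 - a)) * (b * (1 - b))))\<^sup>2"
      using le e ab by (intro power_mono) auto
    also have "\<dots> = lam\<^sup>2 * ((a * (1 - a)) * (b * (1 - b)))"
      using ab by (simp add: power_mult_distrib)
    finally show False by (simp add: power2_eq_square mult_ac)
  qed
  then show ?thesis by (simp add: a_def b_def w_def)
qed

section \<open>Balanced separation by components\<close>

text \<open>Greedy choice: each new set joins the side that is currently not larger, so the two
  sizes never differ by more than \<open>k\<close>.\<close>

lemma balanced_split:
  assumes "finite C" and "pairwise disjnt C" and "\<And>c. c \<in> C \<Longrightarrow> finite c \<and> card c \<le> k"
  shows "\<exists>F \<subseteq> C. card (\<Union>F) \<le> card (\<Union>(C - F)) + k \<and> card (\<Union>(C - F)) \<le> card (\<Union>F) + k"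
  using assms
proof (induction C rule: finite_induct)
  case empty
  then show ?case by simp
next
  case (insert c C)
  then obtain F where F: "F \<subseteq> C" "card (\<Union>F) \<le> card (\<Union>(C - F)) + k"
    "card (\<Union>(C - F)) \<le> card (\<Union>F) + k"
    by (auto simp: pairwise_insert)
  have c: "finite c" "card c \<le> k" using insert.prems by auto
  have card_add: "card (\<Union>(insert c E)) = card c + card (\<Union>E)" if "E \<subseteq> C" for E
  proof -
    have "c \<inter> \<Union>E = {}" using insert.prems(1) insert.hyps(2) that
      by (auto simp: pairwise_insert disjnt_def)
    moreover have "finite (\<Union>E)"
      using that insert.prems(2) finite_subset[OF that insert.hyps(1)] by blast
    ultimately show ?thesis using c by (simp add: card_Un_disjoint)
  qed
  have diff: "insert c C - F = insert c (C - F)" "insert c C - insert c F = C - F"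
    using F(1) insert.hyps(2) by auto
  show ?case
  proof (cases "card (\<Union>F) \<le> card (\<Union>(C - F))")
    case True
    then show ?thesis using F c(2) card_add[OF F(1)]
      by (intro exI[of _ "insert c F"]) (auto simp: diff)
  next
    case False
    then show ?thesis using F c(2) card_add[of "C - F"]
      by (intro exI[of _ F]) (auto simp: diff)
  qed
qed

text \<open>This links maximal connected subgraphs with reachability classes. A connected subgraph
  containing the class of \<open>u\<close> has only vertices reachable from \<open>u\<close>, so it
  cannot have more vertices than the class.\<close>

lemma (in sym_digraph) max_subgraph_connected_reachable:
  assumes u: "u \<in> verts G"
  shows "max_subgraph connected (G \<restriction> {v. u \<rightarrow>\<^sup>* v})"
proof (rule max_subgraphI)
  let ?K = "G \<restriction> {v. u \<rightarrow>\<^sup>* v}"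
  have ind: "induced_subgraph ?K G" by (auto elim: reachable_in_vertsE)
  then show "subgraph ?K G" by (rule induced_imp_subgraph)
  interpret K: sym_digraph ?K by (rule induced_graph_imp_graph[OF ind])
  have "strongly_connected ?K" using induce_reachable_is_in_sccs[OF u] by auto
  then show "connected ?K"
    unfolding connected_def strongly_connected_def
    using K.reachable_mk_symmetric_eq[OF K.sym_arcs] by (simp del: induce_subgraph_verts)
  fix H assume H: "?K \<noteq> H" "subgraph ?K H" "subgraph H G"
  show "\<not> connected H"
  proof
    assume con: "connected H"
    have "u \<in> verts H" using H(2) u by (auto simp: subgraph_def)
    have sub: "subgraph (mk_symmetric H) (mk_symmetric G)" using H(3) by (rule subgraph_mk_symmetric)
    have "verts H \<subseteq> {v. u \<rightarrow>\<^sup>* v}"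
    proof
      fix v assume "v \<in> verts H"
      then have "u \<rightarrow>\<^sup>*\<^bsub>mk_symmetric H\<^esub> v"
        using con \<open>u \<in> verts H\<close> by (auto simp: connected_def strongly_connected_def)
      then have "u \<rightarrow>\<^sup>*\<^bsub>mk_symmetric G\<^esub> v" by (rule pre_digraph.reachable_mono[OF _ sub])
      then show "v \<in> {v. u \<rightarrow>\<^sup>* v}" using reachable_mk_symmetric_eq[OF sym_arcs] by simp
    qed
    then have verts_eq: "verts H = verts ?K" using H(2) by (auto simp: subgraph_def)
    have tail_head: "tail H = tail G" "head H = head G"
      using H(3) by (simp_all add: subgraph_def compatible_def)
    interpret H: wf_digraph H using H(3) by (simp add: subgraph_def)
    \<comment> \<open>With equal vertex sets no arc can be added either, because \<open>?K\<close>
      is induced.\<close>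
    have "e \<in> arcs ?K" if "e \<in> arcs H" for e
      using that H(3) H.tail_in_verts[OF that] H.head_in_verts[OF that]
      by (auto simp: verts_eq tail_head subgraph_def)
    then have "arcs H = arcs ?K" using H(2) by (auto simp: subgraph_def)
    then have "H = ?K" using verts_eq tail_head by simp
    with H(1) show False by simp
  qed
qed

lemma (in graph) card_reachable_le_comp_order:
  assumes U: "U \<subseteq> verts G" and u: "u \<in> U"
  shows "card {v. u \<rightarrow>\<^sup>*\<^bsub>G \<restriction> U\<^esub> v} \<le> comp_order G U"
proof -
  let ?H = "G \<restriction> U"
  let ?C = "{card (verts H) | H. pre_digraph.max_subgraph ?H connected H}"
  interpret H: sym_digraph ?H
    using induced_graph_imp_graph[OF induced_induce[OF U]] .
  have finU: "finite U" by (rule finite_subset[OF U]) simp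
  have "?C \<subseteq> {..card U}"
    using finU by (auto simp: pre_digraph.max_subgraph_def subgraph_def intro!: card_mono)
  then have "finite ?C" using finite_subset by blast
  moreover have "card {v. u \<rightarrow>\<^sup>*\<^bsub>?H\<^esub> v} \<in> ?C"
    using H.max_subgraph_connected_reachable[of u] u by force
  ultimately show ?thesis using u by (auto simp: comp_order_def)
qed

text \<open>For an optimal \<open>S\<close> let \<open>k\<close> be the largest component order of
  \<open>G - S\<close>. A balanced split of the components gives \<open>|X| + |Y| = n - |S|\<close>
  and sizes differing by at most \<open>k\<close>, hence \<open>n - |S| \<le> 2 |X| + k\<close>, and
  likewise for \<open>Y\<close>. Here \<open>|S| + k\<close> is the vertex integrity.\<close>

lemma (in graph) vertex_integrity_separation:
  obtains X Y where "X \<subseteq> verts G" and "Y \<subseteq> verts G" and "X \<inter> Y = {}"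
    and "\<And>x y. x \<in> X \<Longrightarrow> y \<in> Y \<Longrightarrow> (x, y) \<notin> arcs_ends G"
    and "card (verts G) \<le> vertex_integrity G + 2 * card X"
    and "card (verts G) \<le> vertex_integrity G + 2 * card Y"
proof -
  have "vertex_integrity G \<in> (\<lambda>S. card S + comp_order G (verts G - S)) ` Pow (verts G)"
    unfolding vertex_integrity_def by (intro Min_in) auto
  then obtain S where S: "S \<subseteq> verts G"
    and vi: "vertex_integrity G = card S + comp_order G (verts G - S)" by auto
  define U where "U = verts G - S"
  have U: "U \<subseteq> verts G" by (auto simp: U_def)
  have finU: "finite U" by (rule finite_subset[OF U]) simp
  let ?H = "G \<restriction> U" and ?k = "comp_order G U"
  interpret H: sym_digraph ?H
    using induced_graph_imp_graph[OF induced_induce[OF U]] .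
  \<comment> \<open>The classes \<open>R u\<close> for \<open>u \<in> U\<close> are the vertex sets
    of the components of \<open>G - S\<close>.\<close>
  define R where "R = (\<lambda>u. {v. u \<rightarrow>\<^sup>*\<^bsub>?H\<^esub> v})"
  have R_sub: "R u \<subseteq> U" for u by (auto simp: R_def elim: reachable_in_vertsE)
  have R_self: "u \<in> R u" if "u \<in> U" for u using that by (auto simp: R_def)
  have R_eq: "R u = R v" if "w \<in> R u" "w \<in> R v" for u v w
  proof -
    have "u \<rightarrow>\<^sup>*\<^bsub>?H\<^esub> v" "v \<rightarrow>\<^sup>*\<^bsub>?H\<^esub> u"
      using that symmetric_reachable[OF H.sym_arcs] H.reachable_trans unfolding R_def mem_Collect_eq by metis+
    then show ?thesis using H.reachable_trans unfolding R_def by blast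
  qed
  have UR: "\<Union>(R ` U) = U" using R_sub R_self by blast
  have disjoint: "pairwise disjnt (R ` U)"
    using R_eq by (auto simp: pairwise_def disjnt_def)
  have small: "finite c \<and> card c \<le> ?k" if "c \<in> R ` U" for c
  proof -
    from that obtain u where u: "u \<in> U" "c = R u" by blast
    then show ?thesis
      using card_reachable_le_comp_order[OF U u(1)] finite_subset[OF R_sub finU] by (simp add: R_def)
  qed
  obtain F where F: "F \<subseteq> R ` U"
    "card (\<Union>F) \<le> card (\<Union>(R ` U - F)) + ?k" "card (\<Union>(R ` U - F)) \<le> card (\<Union>F) + ?k"
    using balanced_split[OF finite_imageI[OF finU] disjoint small] by blast
  define X Y where "X = \<Union>F" and "Y = \<Union>(R ` U - F)"
  have "X \<union> Y = \<Union>(F \<union> (R ` U - F))" unfolding X_def Y_def by (rule Union_Un_distrib[symmetric])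
  also have "F \<union> (R ` U - F) = R ` U" using F(1) by (rule Un_Diff_cancel[THEN trans, OF Un_absorb1])
  finally have XY: "X \<union> Y = U" using UR by simp
  \<comment> \<open>A class meeting both \<open>X\<close> and \<open>Y\<close> would belong to
    \<open>F\<close> and to its complement at once.\<close>
  have sep: "\<not> (x \<in> R u \<and> y \<in> R u)" if "x \<in> X" "y \<in> Y" for x y u
  proof
    assume *: "x \<in> R u \<and> y \<in> R u"
    obtain c where c: "c \<in> F" "x \<in> c" using \<open>x \<in> X\<close> unfolding X_def by (rule UnionE)
    obtain d where d: "d \<in> R ` U - F" "y \<in> d" using \<open>y \<in> Y\<close> unfolding Y_def by (rule UnionE)
    from c(1) F(1) obtain a where "c = R a" by blast
    moreover from d(1) obtain b where "d = R b" by blast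
    ultimately have "c = d" using * c d R_eq[of x a u] R_eq[of y b u] by simp
    with c d show False by simp
  qed
  have no_arc: "(x, y) \<notin> arcs_ends G" if "x \<in> X" "y \<in> Y" for x y
  proof
    assume "(x, y) \<in> arcs_ends G"
    moreover have xy: "x \<in> U" "y \<in> U" using that XY by auto
    ultimately have "(x, y) \<in> arcs_ends ?H" by (auto simp: arcs_ends_conv)
    then have "y \<in> R x" by (auto simp: R_def)
    then show False using sep[OF that] R_self[OF xy(1)] by blast
  qed
  have disj: "X \<inter> Y = {}"
  proof -
    have False if "x \<in> X" "x \<in> Y" for x
      using sep[OF that] R_self[of x] that XY by blast
    then show ?thesis by blast
  qed
  have "card X + card Y = card U"
    using finU disj XY by (metis card_Un_disjoint finite_Un)
  moreover have "card U + card S = card (verts G)"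
    using S finite_subset[OF S] card_mono[OF _ S] by (simp add: U_def card_Diff_subset)
  ultimately have "card (verts G) \<le> vertex_integrity G + 2 * card X"
    and "card (verts G) \<le> vertex_integrity G + 2 * card Y"
    using F(2,3) vi by (auto simp: X_def Y_def U_def)
  then show thesis using that[of X Y] XY U disj no_arc by blast
qed

section \<open>Matrices of a graph\<close>

text \<open>Otherwise the singleton \<open>{i}\<close> would be closed under positive entries, hence
  all of the at least two indices.\<close>

lemma nonneg_irreducible_row_pos:
  assumes M: "M \<in> carrier_mat n n" and irr: "nonneg_irreducible M" and n: "n \<ge> 2" and i: "i < n"
  shows "\<exists>j < n. M $$ (i, j) > 0"
proof (rule ccontr)
  assume *: "\<not> ?thesis"
  have "{i} \<subseteq> {..<dim_row M}" "\<forall>k \<in> {i}. \<forall>j < dim_col M. M $$ (k, j) > 0 \<longrightarrow> j \<in> {i}"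
    using * i M by auto
  then have "{i} = {..<dim_row M}" using irr unfolding nonneg_irreducible_def by blast
  then have "card {i} = card {..<n}" using M by simp
  then show False using n by simp
qed

locale vertex_enumeration = graph +
  fixes vs :: "'a list"
  assumes distinct_vs: "distinct vs" and set_vs: "set vs = verts G"
begin

abbreviation "n \<equiv> length vs"
abbreviation "A \<equiv> adj_matrix G vs"
abbreviation "N \<equiv> normalized_adj_matrix G vs"
abbreviation deg :: "nat \<Rightarrow> real" where "deg i \<equiv> real (out_degree G (vs ! i))"

lemma length_vs: "n = card (verts G)"
  using distinct_card[OF distinct_vs] set_vs by simp

lemma adj_carrier: "A \<in> carrier_mat n n"
  by (simp add: adj_matrix_def)

lemma adj_nth: "i < n \<Longrightarrow> j < n \<Longrightarrow> A $$ (i, j) = (if (vs ! i, vs ! j) \<in> arcs_ends G then 1 else 0)"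
  by (simp add: adj_matrix_def)

lemma adj_commute: "i < n \<Longrightarrow> j < n \<Longrightarrow> A $$ (i, j) = A $$ (j, i)"
  using sym_arcs by (auto simp: adj_nth symmetric_def dest: symD)

lemma adj_sym: "A\<^sup>T = A"
  using adj_carrier by (intro eq_matI) (auto simp: adj_commute)

text \<open>A closed index set contains, with one vertex, everything reachable from it; in a
  connected symmetric digraph that is every vertex.\<close>

lemma adj_irreducible:
  assumes con: "Digraph_Component.connected G"
  shows "nonneg_irreducible A"
  unfolding nonneg_irreducible_def
proof (intro conjI allI impI)
  fix Z assume Z: "Z \<subseteq> {..<dim_row A}" "Z \<noteq> {}"
    and closed: "\<forall>i \<in> Z. \<forall>j < dim_col A. A $$ (i, j) > 0 \<longrightarrow> j \<in> Z"
  obtain i where i: "i \<in> Z" using Z(2) by blast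
  have Zn: "Z \<subseteq> {..<n}" using Z(1) by (simp add: adj_matrix_def)
  have reach: "v \<in> (!) vs ` Z" if "vs ! i \<rightarrow>\<^sup>* v" for v
    using that
  proof (induction rule: reachable_induct)
    case base
    show ?case using i by simp
  next
    case (step v w)
    then obtain k where k: "k \<in> Z" "v = vs ! k" by auto
    have "w \<in> set vs" using step(2) set_vs by (auto intro: adj_in_verts)
    then obtain j where j: "j < n" "w = vs ! j" by (auto simp: in_set_conv_nth)
    have "A $$ (k, j) > 0" using k j Zn step(2) by (auto simp: adj_nth)
    then have "j \<in> Z" using closed k(1) j(1) adj_carrier by auto
    then show ?case using j(2) by simp
  qed
  have "j \<in> Z" if j: "j < n" for j
  proof -
    have "vs ! i \<rightarrow>\<^sup>* vs ! j"
      using symmetric_connected_imp_strongly_connected[OF sym_arcs con] i j Zn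
      by (auto simp: strongly_connected_def set_vs[symmetric])
    then obtain k where "k \<in> Z" "vs ! j = vs ! k" using reach by auto
    then show ?thesis using j Zn distinct_vs by (auto simp: nth_eq_iff_index_eq)
  qed
  then show "Z = {..<dim_row A}" using Zn by (auto simp: adj_matrix_def)
qed (simp add: adj_matrix_def)

text \<open>The row counts neighbours while the degree counts arcs; without parallel arcs,
  \<open>head G\<close> is injective on the arcs leaving a vertex.\<close>

lemma sum_adj_row:
  assumes i: "i < n"
  shows "(\<Sum>j<n. A $$ (i, j)) = deg i"
proof -
  have "(\<Sum>j<n. A $$ (i, j)) = (\<Sum>j<n. if (vs ! i, vs ! j) \<in> arcs_ends G then 1 else 0)"
    using i by (intro sum.cong) (auto simp: adj_nth)
  also have "\<dots> = (\<Sum>v \<in> verts G. if (vs ! i, v) \<in> arcs_ends G then 1 else 0)"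
    by (rule sum.reindex_bij_betw[OF bij_betw_nth[OF distinct_vs]]) (auto simp: set_vs)
  also have "\<dots> = real (card {v \<in> verts G. (vs ! i, v) \<in> arcs_ends G})"
    by (simp add: sum.If_cases Int_def)
  also have "{v \<in> verts G. (vs ! i, v) \<in> arcs_ends G} = head G ` out_arcs G (vs ! i)"
    by (force simp: arcs_ends_conv out_arcs_def)
  also have "card \<dots> = out_degree G (vs ! i)"
    unfolding out_degree_def
    by (intro card_image inj_onI no_multi_arcs) (auto simp: out_arcs_def arc_to_ends_def)
  finally show ?thesis .
qed

lemma deg_bounds:
  assumes i: "i < n"
  shows "real (min_degree G) \<le> deg i" and "deg i \<le> real (max_degree G)"
proof -
  have "vs ! i \<in> verts G" unfolding set_vs[symmetric] using i by (rule nth_mem)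
  then show "real (min_degree G) \<le> deg i" and "deg i \<le> real (max_degree G)"
    by (auto simp: min_degree_def max_degree_def)
qed

lemma min_degree_attained:
  assumes "n > 0"
  obtains i where "i < n" and "real (min_degree G) = deg i"
proof -
  have "verts G \<noteq> {}" using assms set_vs by auto
  then have "min_degree G \<in> out_degree G ` verts G" unfolding min_degree_def by (intro Min_in) auto
  then obtain v where "v \<in> set vs" "min_degree G = out_degree G v" using set_vs by auto
  then show thesis using that by (auto simp: in_set_conv_nth)
qed

lemma deg_pos:
  assumes "Digraph_Component.connected G" and "n \<ge> 2" and i: "i < n"
  shows "deg i > 0"
proof -
  obtain j where j: "j < n" "A $$ (i, j) > 0"
    using nonneg_irreducible_row_pos[OF adj_carrier adj_irreducible] assms by blast
  have "0 < (\<Sum>j<n. A $$ (i, j))"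
    using i j by (intro sum_pos2[of _ j]) (auto simp: adj_nth)
  then show ?thesis by (simp add: sum_adj_row[OF i])
qed

lemma normalized_adj_carrier: "N \<in> carrier_mat n n"
  by (auto simp: normalized_adj_matrix_def inv_sqrt_deg_matrix_def)

lemma normalized_adj_nth:
  assumes "i < n" and "j < n"
  shows "N $$ (i, j) = A $$ (i, j) / (sqrt (deg i) * sqrt (deg j))"
proof -
  have D: "inv_sqrt_deg_matrix G vs = mat_diag n (\<lambda>i. 1 / sqrt (deg i))"
    unfolding inv_sqrt_deg_matrix_def mat_diag_def by (rule eq_matI) auto
  show ?thesis
    using assms adj_carrier
    by (simp add: normalized_adj_matrix_def D mat_diag_mult_left[of _ n n] mat_diag_mult_right[of _ n n])
qed

lemma normalized_adj_sym: "N\<^sup>T = N"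
  using normalized_adj_carrier
  by (intro eq_matI) (auto simp: normalized_adj_nth adj_commute mult.commute)

text \<open>One side of the balanced separation, transported to indices, satisfies the spectral
  weight bound. Since \<open>M\<close> is any symmetric matrix vanishing off the arcs, this covers
  both the adjacency matrix and its normalization.\<close>

lemma ex_light_set:
  assumes M: "M \<in> carrier_mat n n" and sym: "M\<^sup>T = M"
    and arc: "\<And>i j. i < n \<Longrightarrow> j < n \<Longrightarrow> (vs ! i, vs ! j) \<notin> arcs_ends G \<Longrightarrow> M $$ (i, j) = 0"
    and u: "u \<in> carrier_vec n" "u \<bullet> u = 1" "M *\<^sub>v u = eigval M 1 \<cdot>\<^sub>v u" and e: "eigval M 1 > 0"
  obtains S where "S \<subseteq> {..<n}" and "n \<le> vertex_integrity G + 2 * card S"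
    and "eigval M 1 * (\<Sum>i\<in>S. (u $ i)\<^sup>2)
      \<le> max \<bar>eigval M 2\<bar> \<bar>eigval M n\<bar> * (1 - (\<Sum>i\<in>S. (u $ i)\<^sup>2))"
proof -
  obtain X Y where X: "X \<subseteq> verts G" and Y: "Y \<subseteq> verts G"
    and sep: "\<And>x y. x \<in> X \<Longrightarrow> y \<in> Y \<Longrightarrow> (x, y) \<notin> arcs_ends G"
    and card: "n \<le> vertex_integrity G + 2 * card X" "n \<le> vertex_integrity G + 2 * card Y"
    using vertex_integrity_separation unfolding length_vs by metis
  define ix where "ix = (\<lambda>V. {i. i < n \<and> vs ! i \<in> V})"
  have card_ix: "card (ix V) = card V" if "V \<subseteq> verts G" for V
  proof -
    have "V = (!) vs ` ix V"
    proof (intro equalityI subsetI)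
      fix v assume "v \<in> V"
      then have "v \<in> set vs" using that set_vs by auto
      then obtain i where "i < n" "vs ! i = v" by (auto simp: in_set_conv_nth)
      then show "v \<in> (!) vs ` ix V" using \<open>v \<in> V\<close> by (auto simp: ix_def)
    qed (auto simp: ix_def)
    moreover have "inj_on ((!) vs) (ix V)"
      using distinct_vs by (auto simp: ix_def inj_on_def nth_eq_iff_index_eq)
    ultimately show ?thesis by (metis card_image)
  qed
  have "ix X \<subseteq> {..<n}" "ix Y \<subseteq> {..<n}" by (auto simp: ix_def)
  moreover have "M $$ (i, j) = 0" if "i \<in> ix X" "j \<in> ix Y" for i j
    using that by (intro arc) (auto simp: ix_def sep)
  ultimately show thesis
    using separated_sets_weight[OF M sym u refl e, of "ix X" "ix Y"] that[of "ix X"] that[of "ix Y"]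
      card card_ix[OF X] card_ix[OF Y] by auto
qed

end

section \<open>From weights to cardinalities, and the three bounds\<close>

text \<open>The weight of \<open>S\<close> is at least \<open>card S * l\<close> and that of its
  complement at most \<open>(n - card S) * h\<close>. Inserting both into the weight inequality and
  collecting the terms with \<open>card S\<close> gives the bound.\<close>

lemma card_bound_of_weight:
  fixes w :: "nat \<Rightarrow> real"
  assumes S: "S \<subseteq> {..<n}" and total: "(\<Sum>i<n. w i) = 1"
    and low: "\<And>i. i < n \<Longrightarrow> l \<le> w i" and high: "\<And>i. i < n \<Longrightarrow> w i \<le> h"
    and e: "e \<ge> 0" and lam: "lam \<ge> 0"
    and light: "e * (\<Sum>i\<in>S. w i) \<le> lam * (1 - (\<Sum>i\<in>S. w i))"
  shows "real (card S) * (e * l + lam * h) \<le> lam * real n * h"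
proof -
  have fin: "finite S" using S finite_subset by blast
  have "real (card S) * l \<le> (\<Sum>i\<in>S. w i)"
    using S low by (intro sum_bounded_below) auto
  then have "e * (real (card S) * l) \<le> e * (\<Sum>i\<in>S. w i)"
    using e by (rule mult_left_mono)
  also note light
  also have "1 - (\<Sum>i\<in>S. w i) = (\<Sum>i\<in>{..<n} - S. w i)"
    using S by (simp add: sum_diff total)
  also have "lam * \<dots> \<le> lam * (real (card ({..<n} - S)) * h)"
    using high lam by (intro mult_left_mono sum_bounded_above) auto
  also have "real (card ({..<n} - S)) = real n - real (card S)"
    using S fin card_mono[OF _ S] by (simp add: card_Diff_subset of_nat_diff)
  finally show ?thesis by (simp add: algebra_simps)
qed

theorem theorem23:
  fixes G :: "('a, 'b) pre_digraph" and vs :: "'a list" and n :: nat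
    and A N :: "real mat" and \<nu> :: "real vec"
    and \<delta> \<Delta> lam1 lam \<sigma> \<nu>_min \<nu>_max :: real
  assumes "graph G" and "Digraph_Component.connected G"
    and "n = card (verts G)" and "n \<ge> 2"
    and "distinct vs" and "set vs = verts G"
    and "\<delta> = real (min_degree G)" and "\<Delta> = real (max_degree G)"
    and "A = adj_matrix G vs" and "N = normalized_adj_matrix G vs"
    and "lam1 = eigval A 1"
    and "lam = max \<bar>eigval A 2\<bar> \<bar>eigval A n\<bar>"
    and "\<sigma> = max \<bar>eigval N 2\<bar> \<bar>eigval N n\<bar>"
    and "\<nu> = perron_vector A"
    and "\<nu>_min = Min {\<nu> $ i | i. i < n}" and "\<nu>_max = Max {\<nu> $ i | i. i < n}"
  shows
    "real (vertex_integrity G) \<ge> real n * (1 - 2 * \<sigma> * \<Delta> / (\<delta> * (\<delta> / \<Delta> + \<sigma>)))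
     \<and> real (vertex_integrity G) \<ge> real n * (1 - 2 * lam / (real n * (lam + lam1) * \<nu>_min ^ 2))
     \<and> real (vertex_integrity G) \<ge> real n * (1 - 2 * lam / (lam1 * (\<nu>_min / \<nu>_max) ^ 4 + lam))"
proof -
  interpret G: graph G by fact
  interpret vertex_enumeration G vs by unfold_locales fact+
  have len: "length vs = n" using length_vs assms(3) by simp
  have n0: "n > 0" using assms(4) by simp
  note Ac = adj_carrier[unfolded len, folded assms(9)] and As = adj_sym[folded assms(9)]
    and Airr = adj_irreducible[OF assms(2), folded assms(9)]
    and Nc = normalized_adj_carrier[unfolded len, folded assms(10)]
    and Ns = normalized_adj_sym[folded assms(10)]
    and N_nth = normalized_adj_nth[unfolded len, folded assms(9,10)]
    and A_nth = adj_nth[unfolded len, folded assms(9)]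
    and row_sum = sum_adj_row[unfolded len, folded assms(9)]
    and deg_pos' = deg_pos[OF assms(2), unfolded len, OF assms(4)]
  \<comment> \<open>Each bound reduces to estimating the light set: \<open>t\<close> is an upper
    bound for the fraction \<open>card S / n\<close>.\<close>
  have vi: "real (vertex_integrity G) \<ge> real n * (1 - 2 * t)"
    if "n \<le> vertex_integrity G + 2 * card S" and "real (card S) \<le> real n * t" for S :: "nat set" and t
  proof -
    have "real n \<le> real (vertex_integrity G) + 2 * real (card S)" using that(1) by linarith
    then show ?thesis using that(2) by (simp add: algebra_simps)
  qed
  have lam0: "lam \<ge> 0" "\<sigma> \<ge> 0" by (simp_all add: assms(12,13))

  have i: "real (vertex_integrity G) \<ge> real n * (1 - 2 * (\<sigma> * \<Delta> / (\<delta> * (\<delta> / \<Delta> + \<sigma>))))"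
  proof -
    obtain i where "i < n" "\<delta> = deg i" using min_degree_attained n0 len assms(7) by metis
    then have \<delta>0: "\<delta> > 0" and \<delta>\<Delta>: "\<delta> \<le> \<Delta>"
      using deg_pos' deg_bounds(2) len assms(8) by auto
    define vol where "vol = (\<Sum>i<n. deg i)"
    have vol0: "vol > 0" unfolding vol_def using deg_pos' n0 by (intro sum_pos) auto
    \<comment> \<open>The normalized vector of square roots of degrees is the positive eigenvector
      of \<open>N\<close> for eigenvalue 1: in each row the factors \<open>sqrt (deg j)\<close>
      cancel and a row sum of \<open>A\<close> remains.\<close>
    define u where "u = vec n (\<lambda>i. sqrt (deg i) / sqrt vol)"
    have u: "u \<in> carrier_vec n" by (simp add: u_def)
    have u_sq: "(u $ i)\<^sup>2 = deg i / vol" if "i < n" for i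
      using that vol0 by (simp add: u_def power_divide)
    have total: "(\<Sum>i<n. (u $ i)\<^sup>2) = 1"
      using vol0 by (simp add: u_sq vol_def flip: sum_divide_distrib)
    then have uu: "u \<bullet> u = 1" using u by (simp add: scalar_prod_def lessThan_atLeast0 power2_eq_square)
    have Nu: "N *\<^sub>v u = 1 \<cdot>\<^sub>v u"
    proof (rule eq_vecI)
      fix i assume "i < dim_vec (1 \<cdot>\<^sub>v u)"
      then have i: "i < n" using u by simp
      have "(N *\<^sub>v u) $ i = (\<Sum>j<n. A $$ (i, j) / (sqrt (deg i) * sqrt vol))"
        unfolding mult_mat_vec_nth_sum[OF Nc u i]
        using i deg_pos' by (intro sum.cong) (auto simp: N_nth u_def)
      also have "\<dots> = deg i / (sqrt (deg i) * sqrt vol)"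
        using row_sum[OF i] by (simp flip: sum_divide_distrib)
      also have "\<dots> = (1 \<cdot>\<^sub>v u) $ i"
        using i deg_pos'[OF i] by (simp add: u_def real_div_sqrt flip: divide_divide_eq_left)
      finally show "(N *\<^sub>v u) $ i = (1 \<cdot>\<^sub>v u) $ i" .
    qed (use Nc u in simp)
    have N1: "eigval N 1 = 1"
    proof (rule eigval_1_positive_eigenvector[OF Nc Ns n0 _ u _ Nu])
      show "N $$ (i, j) \<ge> 0" if "i < n" "j < n" for i j using that by (simp add: N_nth A_nth)
      show "u $ i > 0" if "i < n" for i using that deg_pos' vol0 by (simp add: u_def)
    qed
    obtain S where S: "S \<subseteq> {..<n}" "n \<le> vertex_integrity G + 2 * card S"
      and light: "1 * (\<Sum>i\<in>S. (u $ i)\<^sup>2) \<le> \<sigma> * (1 - (\<Sum>i\<in>S. (u $ i)\<^sup>2))"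
      using ex_light_set[unfolded len, OF Nc Ns _ u uu, unfolded N1, OF _ Nu]
      by (auto simp: N_nth A_nth assms(13))
    have *: "real (card S) * (1 * (\<delta> / vol) + \<sigma> * (\<Delta> / vol)) \<le> \<sigma> * real n * (\<Delta> / vol)"
      using deg_bounds len vol0 lam0 assms(7,8)
      by (intro card_bound_of_weight[OF S(1) total _ _ _ _ light])
        (auto simp: u_sq divide_right_mono)
    have "real (card S) * (\<delta> + \<sigma> * \<Delta>) \<le> \<sigma> * real n * \<Delta>"
    proof -
      have "real (card S) * (\<delta> + \<sigma> * \<Delta>) / vol \<le> \<sigma> * real n * \<Delta> / vol"
        using * by (simp add: distrib_left add_divide_distrib)
      then show ?thesis using vol0 by (simp add: divide_le_cancel)
    qed
    \<comment> \<open>The weights \<open>deg i / vol\<close> yield the denominator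
      \<open>\<delta> + \<sigma> * \<Delta>\<close>. The required one is not larger because
      \<open>\<delta> \<le> \<Delta>\<close>, so the required bound is a weakening.\<close>
    moreover have "real (card S) * (\<delta> * (\<delta> / \<Delta> + \<sigma>)) \<le> real (card S) * (\<delta> + \<sigma> * \<Delta>)"
    proof -
      have "\<delta> * (\<delta> / \<Delta>) \<le> \<delta> * 1" using \<delta>0 \<delta>\<Delta> by (intro mult_left_mono) auto
      moreover have "\<delta> * \<sigma> \<le> \<sigma> * \<Delta>"
        using mult_right_mono[OF \<delta>\<Delta> lam0(2)] by (simp add: mult.commute)
      ultimately show ?thesis by (intro mult_left_mono) (simp_all add: distrib_left)
    qed
    ultimately have "real (card S) * (\<delta> * (\<delta> / \<Delta> + \<sigma>)) \<le> \<sigma> * real n * \<Delta>"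
      by linarith
    moreover have "\<delta> * (\<delta> / \<Delta> + \<sigma>) > 0" using \<delta>0 \<delta>\<Delta> lam0 by (simp add: add_pos_nonneg)
    ultimately have "real (card S) \<le> real n * (\<sigma> * \<Delta> / (\<delta> * (\<delta> / \<Delta> + \<sigma>)))"
      by (simp add: pos_le_divide_eq mult_ac)
    with S(2) show ?thesis by (rule vi)
  qed
  have "eigenvector A \<nu> lam1 \<and> (\<forall>i < dim_vec \<nu>. \<nu> $ i > 0) \<and> sqrt (\<nu> \<bullet> \<nu>) = 1"
    using theI'[OF perron_frobenius_symmetric[OF Ac As n0 Airr]]
    unfolding assms(11,14) perron_vector_def .
  then have \<nu>: "\<nu> \<in> carrier_vec n" "A *\<^sub>v \<nu> = lam1 \<cdot>\<^sub>v \<nu>" "\<And>i. i < n \<Longrightarrow> \<nu> $ i > 0" "\<nu> \<bullet> \<nu> = 1"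
    using Ac by (auto simp: eigenvector_def)
  have \<nu>_image: "{\<nu> $ i | i. i < n} = ($) \<nu> ` {..<n}" by auto
  have \<nu>_bounds: "\<nu>_min \<le> \<nu> $ i" "\<nu> $ i \<le> \<nu>_max" if "i < n" for i
    using that unfolding assms(15,16) \<nu>_image by auto
  have \<nu>_min0: "\<nu>_min > 0"
    unfolding assms(15) \<nu>_image using n0 \<nu>(3) by (subst Min_gr_iff) auto
  have \<nu>_min_max: "\<nu>_min \<le> \<nu>_max" using \<nu>_bounds[OF n0] by linarith
  have total: "(\<Sum>i<n. (\<nu> $ i)\<^sup>2) = 1"
    using \<nu>(1,4) by (simp add: scalar_prod_def lessThan_atLeast0 power2_eq_square)
  have lam1_pos: "lam1 > 0"
  proof -
    obtain j where j: "j < n" "A $$ (0, j) > 0"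
      using nonneg_irreducible_row_pos[OF Ac Airr assms(4) n0] by blast
    have "lam1 * \<nu> $ 0 = (\<Sum>j<n. A $$ (0, j) * \<nu> $ j)"
      using mult_mat_vec_nth_sum[OF Ac \<nu>(1) n0] \<nu>(1) n0 by (simp add: \<nu>(2))
    also have "\<dots> > 0"
      using j n0 \<nu>(3) by (intro sum_pos2[of _ j]) (auto simp: A_nth less_imp_le)
    finally show ?thesis using \<nu>(3)[OF n0] by (simp add: zero_less_mult_iff)
  qed
  obtain S where S: "S \<subseteq> {..<n}" "n \<le> vertex_integrity G + 2 * card S"
    and light: "lam1 * (\<Sum>i\<in>S. (\<nu> $ i)\<^sup>2) \<le> lam * (1 - (\<Sum>i\<in>S. (\<nu> $ i)\<^sup>2))"
    using ex_light_set[unfolded len, OF Ac As _ \<nu>(1,4), folded assms(11), OF _ \<nu>(2) lam1_pos]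
    by (auto simp: A_nth assms(12))
  have ii: "real (vertex_integrity G) \<ge> real n * (1 - 2 * (lam / (real n * (lam + lam1) * \<nu>_min ^ 2)))"
  proof -
    \<comment> \<open>Only the lower bound on the entries enters here; \<open>light\<close>
      rearranges to \<open>lam + lam1\<close> times the weight of \<open>S\<close> being at most
      \<open>lam\<close>.\<close>
    have "real (card S) * \<nu>_min\<^sup>2 \<le> (\<Sum>i\<in>S. (\<nu> $ i)\<^sup>2)"
      using S(1) \<nu>_bounds(1) \<nu>_min0 by (intro sum_bounded_below power_mono) auto
    then have "(lam + lam1) * (real (card S) * \<nu>_min\<^sup>2) \<le> (lam + lam1) * (\<Sum>i\<in>S. (\<nu> $ i)\<^sup>2)"
      using lam0 lam1_pos by (intro mult_left_mono) auto
    also have "\<dots> \<le> lam" using light by (simp add: algebra_simps)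
    finally have "real (card S) * ((lam + lam1) * \<nu>_min\<^sup>2) \<le> lam" by (simp add: mult_ac)
    moreover have "(lam + lam1) * \<nu>_min\<^sup>2 > 0" using lam0 lam1_pos \<nu>_min0 by (simp add: add_nonneg_pos)
    ultimately have "real (card S) \<le> lam / ((lam + lam1) * \<nu>_min\<^sup>2)"
      by (simp add: pos_le_divide_eq)
    also have "\<dots> = real n * (lam / (real n * (lam + lam1) * \<nu>_min\<^sup>2))"
      using n0 by (simp add: mult.assoc)
    finally show ?thesis using S(2) by (intro vi)
  qed
  have iii: "real (vertex_integrity G) \<ge> real n * (1 - 2 * (lam / (lam1 * (\<nu>_min / \<nu>_max) ^ 4 + lam)))"
  proof -
    let ?r = "\<nu>_min / \<nu>_max"
    have max0: "\<nu>_max > 0" using \<nu>_min0 \<nu>_min_max by linarith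
    have r: "0 < ?r" "?r \<le> 1" using \<nu>_min0 \<nu>_min_max max0 by auto
    \<comment> \<open>Now the entries are bounded on both sides, with weights
      \<open>(\<nu> $ i)\<^sup>2\<close> between \<open>\<nu>_min\<^sup>2\<close> and
      \<open>\<nu>_max\<^sup>2\<close>.\<close>
    have "real (card S) * (lam1 * \<nu>_min\<^sup>2 + lam * \<nu>_max\<^sup>2) \<le> lam * real n * \<nu>_max\<^sup>2"
    proof (rule card_bound_of_weight[OF S(1) total _ _ _ _ light])
      show "\<nu>_min\<^sup>2 \<le> (\<nu> $ i)\<^sup>2" if "i < n" for i
        using \<nu>_bounds(1)[OF that] \<nu>_min0 by (intro power_mono) auto
      show "(\<nu> $ i)\<^sup>2 \<le> \<nu>_max\<^sup>2" if "i < n" for i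
        using \<nu>_bounds(2)[OF that] \<nu>(3)[OF that] by (intro power_mono) auto
    qed (use lam0 lam1_pos in auto)
    moreover have "\<nu>_min\<^sup>2 = ?r\<^sup>2 * \<nu>_max\<^sup>2" using max0 by (simp add: power_divide)
    ultimately have "real (card S) * (lam1 * ?r\<^sup>2 + lam) * \<nu>_max\<^sup>2 \<le> lam * real n * \<nu>_max\<^sup>2"
      by (simp only: distrib_left distrib_right mult_ac)
    then have "real (card S) * (lam1 * ?r\<^sup>2 + lam) \<le> lam * real n"
      by (rule mult_right_le_imp_le) (use max0 in simp)
    \<comment> \<open>The argument gives exponent 2; since \<open>?r \<le> 1\<close>, passing to
      exponent 4 decreases the denominator and weakens the bound to the required one.\<close>
    moreover have "real (card S) * (lam1 * ?r ^ 4 + lam) \<le> real (card S) * (lam1 * ?r\<^sup>2 + lam)"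
      using r lam1_pos by (intro mult_left_mono add_right_mono power_decreasing) auto
    ultimately have "real (card S) * (lam1 * ?r ^ 4 + lam) \<le> lam * real n"
      by linarith
    moreover have "lam1 * ?r ^ 4 + lam > 0"
      using r(1) lam0 lam1_pos by (intro add_pos_nonneg mult_pos_pos zero_less_power)
    ultimately have "real (card S) \<le> real n * (lam / (lam1 * ?r ^ 4 + lam))"
      by (simp add: pos_le_divide_eq mult_ac)
    with S(2) show ?thesis by (rule vi)
  qed
  show ?thesis using i ii iii by (simp add: mult.assoc)
qed

end
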